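(* Let $k$ be a field. Every cosemisimple coalgebra over $k$ is symmetric.
   Context: For a coalgebra $C$ over $k$ with $\Delta(x)=\sum x_1\otimes x_2$, the dual $C^*$ is an algebra with the convolution product $(c^*d^* )(x)=\sum c^*(x_1)d^*(x_2)$. $C$ is a $(C^*,C^* )$-bimodule with $c^*\cdot x=\sum c^*(x_2)x_1$ and $x\cdot c^*=\sum c^*(x_1)x_2$; $C^*$ is a bimodule over itself by multiplication. $C$ is symmetric if there exists an injective morphism $C\to C^*$ of $(C^*,C^* )$-bimodules. $C$ is cosemisimple if it is a direct sum of simple subcoalgebras (equivalently, every comodule is semisimple). Coalgebras are not assumed finite dimensional. *)

theory Defs
  imports Complex_Main "HOL-Library.Poly_Mapping"
begin

text \<open>
  Tensor powers of a vector space are built as quotients of the free vector space on the set of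
  tuples \<open>'i\<close> (\<open>'c \<times> 'c\<close> for \<open>C \<otimes> C\<close>, and \<open>'c \<times> 'c \<times> 'c\<close> for \<open>C \<otimes> C \<otimes> C\<close>). A slot is a map
  \<open>'c \<Rightarrow> 'i\<close> that varies one entry of a tuple and keeps the other entries fixed; the relations force
  the universal map to be linear along every slot. An element of a tensor power is a coset, i.e. a
  set of formal linear combinations of tuples.
\<close>

definition free_scale :: "'k::field \<Rightarrow> ('i \<Rightarrow>\<^sub>0 'k) \<Rightarrow> ('i \<Rightarrow>\<^sub>0 'k)" where
  "free_scale c t = Poly_Mapping.map ((*) c) t"

definition tensor_relations ::
    "('k::field \<Rightarrow> 'c::ab_group_add \<Rightarrow> 'c) \<Rightarrow> ('c \<Rightarrow> 'i) set \<Rightarrow> ('i \<Rightarrow>\<^sub>0 'k) set" where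
  "tensor_relations scale slots = module.span free_scale
     ({Poly_Mapping.single (h (a + b)) 1 - Poly_Mapping.single (h a) 1 - Poly_Mapping.single (h b) 1
        | h a b. h \<in> slots} \<union>
      {Poly_Mapping.single (h (scale c a)) 1 - free_scale c (Poly_Mapping.single (h a) 1)
        | h c a. h \<in> slots})"

definition tensor_class ::
    "('k::field \<Rightarrow> 'c::ab_group_add \<Rightarrow> 'c) \<Rightarrow> ('c \<Rightarrow> 'i) set \<Rightarrow> ('i \<Rightarrow>\<^sub>0 'k) \<Rightarrow> ('i \<Rightarrow>\<^sub>0 'k) set" where
  "tensor_class scale slots t = {u. u - t \<in> tensor_relations scale slots}"

definition slots2 :: "('c \<Rightarrow> 'c \<times> 'c) set" where
  "slots2 = {(\<lambda>a. (a, y)) | y. True} \<union> {(\<lambda>a. (x, a)) | x. True}"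

definition slots3 :: "('c \<Rightarrow> 'c \<times> 'c \<times> 'c) set" where
  "slots3 = {(\<lambda>a. (a, y, z)) | y z. True} \<union> {(\<lambda>a. (x, a, z)) | x z. True}
     \<union> {(\<lambda>a. (x, y, a)) | x y. True}"

abbreviation tensor2 ::
    "('k::field \<Rightarrow> 'c::ab_group_add \<Rightarrow> 'c) \<Rightarrow> ('c \<times> 'c \<Rightarrow>\<^sub>0 'k) \<Rightarrow> ('c \<times> 'c \<Rightarrow>\<^sub>0 'k) set" where
  "tensor2 scale \<equiv> tensor_class scale slots2"

abbreviation tensor3 ::
    "('k::field \<Rightarrow> 'c::ab_group_add \<Rightarrow> 'c) \<Rightarrow> ('c \<times> 'c \<times> 'c \<Rightarrow>\<^sub>0 'k) \<Rightarrow> ('c \<times> 'c \<times> 'c \<Rightarrow>\<^sub>0 'k) set" where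
  "tensor3 scale \<equiv> tensor_class scale slots3"

definition formal_eval ::
    "('k::field \<Rightarrow> 'm::ab_group_add \<Rightarrow> 'm) \<Rightarrow> ('c \<Rightarrow> 'c \<Rightarrow> 'm) \<Rightarrow> ('c \<times> 'c \<Rightarrow>\<^sub>0 'k) \<Rightarrow> 'm" where
  "formal_eval sm B t =
     (\<Sum>p\<in>Poly_Mapping.keys t. sm (Poly_Mapping.lookup t p) (B (fst p) (snd p)))"

text \<open>
  Sweedler notation: \<open>sweedler sm B (\<Delta> x)\<close> is \<open>\<Sum> B x\<^sub>1 x\<^sub>2\<close>. For bilinear \<open>B\<close> the choice of the
  representative is irrelevant, see \<open>sweedler_tensor2\<close> below.
\<close>

definition sweedler ::
    "('k::field \<Rightarrow> 'm::ab_group_add \<Rightarrow> 'm) \<Rightarrow> ('c \<Rightarrow> 'c \<Rightarrow> 'm) \<Rightarrow> ('c \<times> 'c \<Rightarrow>\<^sub>0 'k) set \<Rightarrow> 'm" where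
  "sweedler sm B T = formal_eval sm B (SOME t. t \<in> T)"

text \<open>
  In \<open>coassoc\<close> the inner and outer sums are formed from representatives in the free vector space on
  triples; the class in \<open>C \<otimes> C \<otimes> C\<close> does not depend on them.
\<close>

locale coalgebra = vector_space scale
  for scale :: "'k::field \<Rightarrow> 'c::ab_group_add \<Rightarrow> 'c" +
  fixes \<Delta> :: "'c \<Rightarrow> ('c \<times> 'c \<Rightarrow>\<^sub>0 'k) set"
    and \<epsilon> :: "'c \<Rightarrow> 'k"
  assumes comult_tensor: "\<Delta> x \<in> range (tensor2 scale)"
    and comult_add: "s \<in> \<Delta> x \<Longrightarrow> t \<in> \<Delta> y \<Longrightarrow> \<Delta> (x + y) = tensor2 scale (s + t)"
    and comult_scale: "t \<in> \<Delta> x \<Longrightarrow> \<Delta> (scale c x) = tensor2 scale (free_scale c t)"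
    and counit_linear: "Vector_Spaces.linear scale (*) \<epsilon>"
    and coassoc:
      "tensor3 scale (sweedler free_scale
          (\<lambda>a b. sweedler free_scale (\<lambda>p q. Poly_Mapping.single (p, q, b) 1) (\<Delta> a)) (\<Delta> x)) =
       tensor3 scale (sweedler free_scale
          (\<lambda>a b. sweedler free_scale (\<lambda>p q. Poly_Mapping.single (a, p, q) 1) (\<Delta> b)) (\<Delta> x))"
    and counit_left: "sweedler scale (\<lambda>a b. scale (\<epsilon> a) b) (\<Delta> x) = x"
    and counit_right: "sweedler scale (\<lambda>a b. scale (\<epsilon> b) a) (\<Delta> x) = x"
begin

definition dual :: "('c \<Rightarrow> 'k) set" where
  "dual = {f. Vector_Spaces.linear scale (*) f}"

definition convolution :: "('c \<Rightarrow> 'k) \<Rightarrow> ('c \<Rightarrow> 'k) \<Rightarrow> 'c \<Rightarrow> 'k" where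
  "convolution f g x = sweedler (*) (\<lambda>a b. f a * g b) (\<Delta> x)"

definition left_act :: "('c \<Rightarrow> 'k) \<Rightarrow> 'c \<Rightarrow> 'c" where
  "left_act f x = sweedler scale (\<lambda>a b. scale (f b) a) (\<Delta> x)"

definition right_act :: "'c \<Rightarrow> ('c \<Rightarrow> 'k) \<Rightarrow> 'c" where
  "right_act x f = sweedler scale (\<lambda>a b. scale (f a) b) (\<Delta> x)"

definition bimodule_morphism_to_dual :: "('c \<Rightarrow> 'c \<Rightarrow> 'k) \<Rightarrow> bool" where
  "bimodule_morphism_to_dual \<phi> \<longleftrightarrow>
     (\<forall>x. \<phi> x \<in> dual) \<and>
     (\<forall>x y. \<phi> (x + y) = (\<lambda>z. \<phi> x z + \<phi> y z)) \<and>
     (\<forall>c x. \<phi> (scale c x) = (\<lambda>z. c * \<phi> x z)) \<and>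
     (\<forall>f\<in>dual. \<forall>x. \<phi> (left_act f x) = convolution f (\<phi> x)) \<and>
     (\<forall>f\<in>dual. \<forall>x. \<phi> (right_act x f) = convolution (\<phi> x) f)"

definition symmetric :: bool where
  "symmetric \<longleftrightarrow> (\<exists>\<phi>. bimodule_morphism_to_dual \<phi> \<and> inj \<phi>)"

text \<open>
  Over a field \<open>D \<otimes> D\<close> embeds in \<open>C \<otimes> C\<close> as the classes of combinations of pairs from \<open>D \<times> D\<close>.
\<close>

definition subcoalgebra :: "'c set \<Rightarrow> bool" where
  "subcoalgebra D \<longleftrightarrow>
     subspace D \<and> (\<forall>x\<in>D. \<exists>t. Poly_Mapping.keys t \<subseteq> D \<times> D \<and> \<Delta> x = tensor2 scale t)"

definition simple_subcoalgebra :: "'c set \<Rightarrow> bool" where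
  "simple_subcoalgebra D \<longleftrightarrow>
     subcoalgebra D \<and> D \<noteq> {0} \<and> (\<forall>E. subcoalgebra E \<and> E \<subseteq> D \<longrightarrow> E = {0} \<or> E = D)"

text \<open>
  The summands of a direct sum of nonzero subspaces are distinct, so the family of simple
  subcoalgebras can be taken to be a set.
\<close>

definition cosemisimple :: bool where
  "cosemisimple \<longleftrightarrow>
     (\<exists>\<D>. (\<forall>D\<in>\<D>. simple_subcoalgebra D) \<and> span (\<Union>\<D>) = UNIV \<and>
        (\<forall>D\<in>\<D>. D \<inter> span (\<Union>(\<D> - {D})) = {0}))"

end

lemma lookup_free_scale: "Poly_Mapping.lookup (free_scale c t) p = c * Poly_Mapping.lookup t p"
  by (simp add: free_scale_def map.rep_eq when_def)

interpretation free_vs: vector_space "free_scale :: 'k::field \<Rightarrow> ('i \<Rightarrow>\<^sub>0 'k) \<Rightarrow> ('i \<Rightarrow>\<^sub>0 'k)"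
  by unfold_locales
    (auto simp: poly_mapping_eq_iff fun_eq_iff lookup_add lookup_free_scale algebra_simps)

lemma formal_eval_superset:
  assumes "vector_space sm" "finite A" "Poly_Mapping.keys t \<subseteq> A"
  shows "formal_eval sm B t = (\<Sum>p\<in>A. sm (Poly_Mapping.lookup t p) (B (fst p) (snd p)))"
proof -
  interpret m: vector_space sm by fact
  show ?thesis unfolding formal_eval_def
    by (rule sum.mono_neutral_left[OF assms(2,3)]) (auto simp: in_keys_iff)
qed

lemma formal_eval_linear:
  assumes "vector_space sm"
  shows "Vector_Spaces.linear free_scale sm (formal_eval sm B)"
proof -
  interpret m: vector_space sm by fact
  show ?thesis
  proof (unfold_locales, goal_cases)
    case (1 s t)
    let ?A = "Poly_Mapping.keys s \<union> Poly_Mapping.keys t \<union> Poly_Mapping.keys (s + t)"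
    have "formal_eval sm B u = (\<Sum>p\<in>?A. sm (Poly_Mapping.lookup u p) (B (fst p) (snd p)))"
      if "u \<in> {s, t, s + t}" for u
      using that by (intro formal_eval_superset assms) auto
    then show ?case by (simp add: lookup_add m.scale_left_distrib sum.distrib)
  next
    case (2 c t)
    have "Poly_Mapping.keys (free_scale c t) \<subseteq> Poly_Mapping.keys t"
      by (auto simp: in_keys_iff lookup_free_scale)
    then have "formal_eval sm B (free_scale c t) =
        (\<Sum>p\<in>Poly_Mapping.keys t. sm (c * Poly_Mapping.lookup t p) (B (fst p) (snd p)))"
      by (subst formal_eval_superset[OF assms, of "Poly_Mapping.keys t"])
        (simp_all add: lookup_free_scale)
    then show ?case by (simp add: formal_eval_def m.scale_sum_right)
  qed
qed

lemma formal_eval_single: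
  assumes "vector_space sm"
  shows "formal_eval sm B (Poly_Mapping.single (a, b) c) = sm c (B a b)"
proof -
  interpret m: vector_space sm by fact
  show ?thesis by (subst formal_eval_superset[OF assms, of "{(a, b)}"]) auto
qed

lemma sweedler_tensor2:
  fixes scale :: "'k::field \<Rightarrow> 'c::ab_group_add \<Rightarrow> 'c"
    and sm :: "'k \<Rightarrow> 'm::ab_group_add \<Rightarrow> 'm"
  assumes sm: "vector_space sm"
    and l: "\<And>b. Vector_Spaces.linear scale sm (\<lambda>a. B a b)"
    and r: "\<And>a. Vector_Spaces.linear scale sm (B a)"
  shows "sweedler sm B (tensor2 scale t) = formal_eval sm B t"
proof -
  interpret ev: Vector_Spaces.linear free_scale sm "formal_eval sm B"
    by (rule formal_eval_linear[OF sm])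
  interpret L: Vector_Spaces.linear scale sm "\<lambda>a. B a b" for b by (rule l)
  interpret R: Vector_Spaces.linear scale sm "B a" for a by (rule r)
  have zero: "formal_eval sm B u = 0" if "u \<in> tensor_relations scale slots2" for u
    using that unfolding tensor_relations_def
  proof (rule free_vs.span_induct)
    show "free_vs.subspace {u. formal_eval sm B u = 0}"
      by (rule ev.subspace_kernel)
  qed (auto simp: slots2_def ev.diff ev.scale formal_eval_single[OF sm]
      L.add R.add L.scale R.scale)
  have "t \<in> tensor2 scale t"
    by (simp add: tensor_class_def tensor_relations_def free_vs.span_zero)
  then have "(SOME u. u \<in> tensor2 scale t) \<in> tensor2 scale t" by (rule someI)
  then have "formal_eval sm B ((SOME u. u \<in> tensor2 scale t) - t) = 0"
    by (intro zero) (simp add: tensor_class_def)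
  then show ?thesis by (simp add: sweedler_def ev.diff)
qed

end

theory Submission
  imports Defs "HOL-Library.Function_Algebras"
begin

text \<open>
  A simple subcoalgebra \<open>D\<close> is finite dimensional, and its dual is a finite-dimensional
  simple algebra. Every such algebra, over any field, carries a nonzero functional \<open>\<tau>\<close> with
  \<open>\<tau> (a b) = \<tau> (b a)\<close> (\<open>trace_exists\<close>). As \<open>D\<close> is finite dimensional, \<open>\<tau>\<close> is evaluation at
  some nonzero \<open>z\<close> in \<open>D\<close>, and the trace property says \<open>f \<cdot> z = z \<cdot> f\<close> for all functionals
  \<open>f\<close> (\<open>central_element_exists\<close>). Hence \<open>f \<mapsto> f \<cdot> z\<close> is a morphism of bimodules from the dual
  to \<open>D\<close>. Its image is a nonzero sub-bimodule, that is, a nonzero subcoalgebra, so it is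
  \<open>D\<close>; its kernel consists of the functionals that vanish on \<open>D\<close>
  (\<open>central_element_generates\<close>). So \<open>D\<close> is isomorphic to its dual as a bimodule.

  For \<open>C = \<Oplus> D\<close>, these isomorphisms fit together: the wanted map sends \<open>x\<close> to the unique
  functional \<open>f\<close> on \<open>C\<close> such that \<open>f \<cdot> z\<^sub>D\<close> is the \<open>D\<close>-component of \<open>x\<close>, for every \<open>D\<close>.
  Since \<open>x\<close> is the sum of its components, \<open>f\<close> determines \<open>x\<close>.

  The trace is the crux, because in positive characteristic the trace of the regular
  representation may be zero. Consider operators \<open>T c = \<Sum> u\<^sub>i c v\<^sub>i\<close> of a simple algebra
  \<open>A\<close>, and the reversed operators \<open>T' c = \<Sum> v\<^sub>i c u\<^sub>i\<close>. If \<open>T\<close> has only central values, then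
  \<open>\<Sum> (a u\<^sub>i) c v\<^sub>i - \<Sum> u\<^sub>i c (v\<^sub>i a) = 0\<close> for all \<open>a\<close> and \<open>c\<close>. Reversing this identity gives
  \<open>T' (c a) = T' (a c)\<close>, so \<open>T'\<close> vanishes on commutators. This uses that the reverse of an
  operator does not depend on its presentation (\<open>sandwich_swap_eq_0\<close>), which also yields
  \<open>T' \<noteq> 0\<close> when \<open>T \<noteq> 0\<close>. Thus the commutators do not span \<open>A\<close>. An operator \<open>T \<noteq> 0\<close> with
  central values is found by making its kernel as large as possible
  (\<open>central_sandwich_exists\<close>). In matrix algebras \<open>T\<close> can be the map \<open>c \<mapsto> tr(c) 1\<close>.
\<close>

section \<open>Traces on finite-dimensional simple algebras\<close>

lemma separating_functional:
  fixes s :: "'k::field \<Rightarrow> 'a::ab_group_add \<Rightarrow> 'a"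
  assumes "vector_space s" "module.subspace s U" "x \<notin> U"
  shows "\<exists>f. Vector_Spaces.linear s (*) f \<and> f x = 1 \<and> (\<forall>u\<in>U. f u = 0)"
proof -
  interpret vector_space s by fact
  interpret vp: vector_space_pair s "(*) :: 'k \<Rightarrow> 'k \<Rightarrow> 'k"
    by (intro vector_space_pair.intro assms(1)) (unfold_locales; simp add: algebra_simps)
  obtain B where B: "B \<subseteq> U" "independent B" "U \<subseteq> span B"
    by (rule basis_exists)
  have x: "x \<notin> span B" using B(1) assms(2,3) span_minimal by blast
  then have "independent (insert x B)" "x \<notin> B"
    using B(2) by (auto simp: independent_insert span_base)
  from vp.linear_independent_extend[OF this(1), of "\<lambda>b. if b = x then 1 else 0"]
  obtain f where f: "Vector_Spaces.linear s (*) f"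
    "\<And>b. b \<in> insert x B \<Longrightarrow> f b = (if b = x then 1 else 0)" by blast
  interpret f: Vector_Spaces.linear s "(*)" f by (rule f)
  have "f u = 0" if "u \<in> span B" for u
    using that
  proof (rule span_induct)
    show "subspace {u. f u = 0}" by (rule f.subspace_kernel)
  qed (use f(2) \<open>x \<notin> B\<close> in auto)
  then show ?thesis using f(1) f(2)[of x] B(3) by auto
qed

text \<open>
  The algebra is a subset \<open>A\<close> of a larger vector space: in the application \<open>A\<close> consists of
  the linear maps in the type of all functions on \<open>C\<close>, and its product depends on the
  comultiplication.
\<close>

locale fd_simple_algebra = vector_space sc
  for sc :: "'k::field \<Rightarrow> 'a::ab_group_add \<Rightarrow> 'a" +
  fixes A :: "'a set" and mul :: "'a \<Rightarrow> 'a \<Rightarrow> 'a" (infixl "\<star>" 70) and one :: 'a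
  assumes subspace_carrier: "subspace A"
    and mul_closed [simp]: "a \<in> A \<Longrightarrow> b \<in> A \<Longrightarrow> a \<star> b \<in> A"
    and one_closed [simp]: "one \<in> A"
    and mul_assoc: "a \<in> A \<Longrightarrow> b \<in> A \<Longrightarrow> c \<in> A \<Longrightarrow> a \<star> b \<star> c = a \<star> (b \<star> c)"
    and mul_add_left: "a \<in> A \<Longrightarrow> b \<in> A \<Longrightarrow> c \<in> A \<Longrightarrow> (a + b) \<star> c = a \<star> c + b \<star> c"
    and mul_add_right: "a \<in> A \<Longrightarrow> b \<in> A \<Longrightarrow> c \<in> A \<Longrightarrow> a \<star> (b + c) = a \<star> b + a \<star> c"
    and mul_scale_left: "a \<in> A \<Longrightarrow> b \<in> A \<Longrightarrow> sc r a \<star> b = sc r (a \<star> b)"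
    and mul_scale_right: "a \<in> A \<Longrightarrow> b \<in> A \<Longrightarrow> a \<star> sc r b = sc r (a \<star> b)"
    and one_mul [simp]: "a \<in> A \<Longrightarrow> one \<star> a = a"
    and mul_one [simp]: "a \<in> A \<Longrightarrow> a \<star> one = a"
    and nontrivial: "A \<noteq> {0}"
    and simple: "subspace I \<Longrightarrow> I \<subseteq> A \<Longrightarrow> (\<And>a i. a \<in> A \<Longrightarrow> i \<in> I \<Longrightarrow> a \<star> i \<in> I \<and> i \<star> a \<in> I) \<Longrightarrow>
      I = {0} \<or> I = A"
    and finite_dimensional: "\<exists>B. finite B \<and> A \<subseteq> span B"
begin

lemma carrier_closed [simp]:
  "0 \<in> A" "a \<in> A \<Longrightarrow> b \<in> A \<Longrightarrow> a + b \<in> A" "a \<in> A \<Longrightarrow> b \<in> A \<Longrightarrow> a - b \<in> A"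
  "a \<in> A \<Longrightarrow> - a \<in> A" "a \<in> A \<Longrightarrow> sc r a \<in> A"
  using subspace_carrier by (auto intro: subspace_0 subspace_add subspace_diff subspace_neg subspace_scale)

lemma mul_zero [simp]: "a \<in> A \<Longrightarrow> 0 \<star> a = 0" "a \<in> A \<Longrightarrow> a \<star> 0 = 0"
  using mul_scale_left[of 0 a 0] mul_scale_right[of a 0 0] by simp_all

lemma mul_minus:
  "a \<in> A \<Longrightarrow> b \<in> A \<Longrightarrow> (- a) \<star> b = - (a \<star> b)" "a \<in> A \<Longrightarrow> b \<in> A \<Longrightarrow> a \<star> (- b) = - (a \<star> b)"
  using mul_scale_left[of a b "-1"] mul_scale_right[of a b "-1"] by simp_all

lemma mul_diff:
  "a \<in> A \<Longrightarrow> b \<in> A \<Longrightarrow> c \<in> A \<Longrightarrow> (a - b) \<star> c = a \<star> c - b \<star> c"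
  "a \<in> A \<Longrightarrow> b \<in> A \<Longrightarrow> c \<in> A \<Longrightarrow> a \<star> (b - c) = a \<star> b - a \<star> c"
  using mul_add_left[of a "-b" c] mul_add_right[of a b "-c"] by (simp_all add: mul_minus)

text \<open>
  The operators \<open>sandwich ps\<close> form the multiplication algebra of \<open>A\<close>. The list \<open>ps\<close> is kept
  since the reversed operator is defined by the list; that it depends only on the operator
  is a theorem.
\<close>

definition sandwich :: "('a \<times> 'a) list \<Rightarrow> 'a \<Rightarrow> 'a" where
  "sandwich ps c = (\<Sum>(u, v)\<leftarrow>ps. u \<star> c \<star> v)"

lemma sandwich_simps [simp]:
  "sandwich [] c = 0" "sandwich ((u, v) # ps) c = u \<star> c \<star> v + sandwich ps c"
  "sandwich (ps @ qs) c = sandwich ps c + sandwich qs c"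
  by (simp_all add: sandwich_def)

lemma sandwich_closed [simp]: "set ps \<subseteq> A \<times> A \<Longrightarrow> c \<in> A \<Longrightarrow> sandwich ps c \<in> A"
  by (induction ps) auto

lemma sandwich_add: "set ps \<subseteq> A \<times> A \<Longrightarrow> c \<in> A \<Longrightarrow> d \<in> A \<Longrightarrow>
    sandwich ps (c + d) = sandwich ps c + sandwich ps d"
  by (induction ps) (auto simp: mul_add_left mul_add_right algebra_simps)

lemma sandwich_scale: "set ps \<subseteq> A \<times> A \<Longrightarrow> c \<in> A \<Longrightarrow> sandwich ps (sc r c) = sc r (sandwich ps c)"
  by (induction ps) (auto simp: mul_scale_left mul_scale_right scale_right_distrib)

lemma sandwich_zero: "set ps \<subseteq> A \<times> A \<Longrightarrow> sandwich ps 0 = 0"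
  by (induction ps) auto

lemma sandwich_diff: "set ps \<subseteq> A \<times> A \<Longrightarrow> c \<in> A \<Longrightarrow> d \<in> A \<Longrightarrow>
    sandwich ps (c - d) = sandwich ps c - sandwich ps d"
  by (induction ps) (auto simp: mul_diff algebra_simps)

lemma sandwich_kernel: "set ps \<subseteq> A \<times> A \<Longrightarrow> subspace {c \<in> A. sandwich ps c = 0}"
  by (rule subspaceI) (auto simp: sandwich_add sandwich_scale sandwich_zero)

definition wrap :: "'a \<Rightarrow> 'a \<Rightarrow> ('a \<times> 'a) list \<Rightarrow> ('a \<times> 'a) list" where
  "wrap u v = map (\<lambda>(x, y). (u \<star> x, y \<star> v))"

lemma wrap_closed [simp]: "u \<in> A \<Longrightarrow> v \<in> A \<Longrightarrow> set ps \<subseteq> A \<times> A \<Longrightarrow> set (wrap u v ps) \<subseteq> A \<times> A"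
  by (auto simp: wrap_def)

lemma sandwich_wrap: "u \<in> A \<Longrightarrow> v \<in> A \<Longrightarrow> set ps \<subseteq> A \<times> A \<Longrightarrow> c \<in> A \<Longrightarrow>
    sandwich (wrap u v ps) c = u \<star> sandwich ps c \<star> v"
  by (induction ps) (auto simp: wrap_def mul_add_left mul_add_right mul_assoc)

lemma sandwich_compose:
  assumes "set ps \<subseteq> A \<times> A" "set qs \<subseteq> A \<times> A"
  shows "\<exists>rs. set rs \<subseteq> A \<times> A \<and> (\<forall>c\<in>A. sandwich rs c = sandwich qs (sandwich ps c))"
  using assms(2)
proof (induction qs)
  case Nil
  show ?case by (rule exI[of _ "[]"]) auto
next
  case (Cons q qs)
  then obtain rs where "set rs \<subseteq> A \<times> A" "\<forall>c\<in>A. sandwich rs c = sandwich qs (sandwich ps c)"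
    by auto
  with Cons.prems assms(1) show ?case
    by (cases q) (auto intro!: exI[of _ "wrap (fst q) (snd q) ps @ rs"]
        simp: sandwich_wrap dest: subsetD[OF wrap_closed, rotated 3])
qed

text \<open>
  The values \<open>sandwich ps y\<close> fill the two-sided ideal generated by \<open>y\<close>, and this is \<open>A\<close>.
\<close>

lemma sandwich_hits:
  assumes "y \<in> A" "y \<noteq> 0" "w \<in> A"
  shows "\<exists>ps. set ps \<subseteq> A \<times> A \<and> sandwich ps y = w"
proof -
  let ?I = "{sandwich ps y | ps. set ps \<subseteq> A \<times> A}"
  have "?I = {0} \<or> ?I = A"
  proof (rule simple)
    have wr: "a \<star> i \<star> b \<in> ?I" if "a \<in> A" "b \<in> A" "i \<in> ?I" for a b i
      using that assms(1) by (force simp: sandwich_wrap[symmetric] dest: wrap_closed)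
    have sub: "?I \<subseteq> A" using assms(1) by auto
    then show "?I \<subseteq> A" .
    show "subspace ?I"
    proof (rule subspaceI)
      show "0 \<in> ?I" by (rule CollectI, rule exI[of _ "[]"]) auto
      show "x + z \<in> ?I" if xz: "x \<in> ?I" "z \<in> ?I" for x z
      proof -
        obtain ps qs where "x = sandwich ps y" "set ps \<subseteq> A \<times> A" "z = sandwich qs y" "set qs \<subseteq> A \<times> A"
          using xz by auto
        then show ?thesis by (intro CollectI exI[of _ "ps @ qs"]) auto
      qed
      show "sc r x \<in> ?I" if "x \<in> ?I" for r x
      proof -
        have "x \<in> A" using that sub by blast
        then have "sc r one \<star> x \<star> one = sc r x" by (simp add: mul_scale_left)
        then show ?thesis using wr[of "sc r one" one x] that by simp
      qed
    qed
    show "a \<star> i \<in> ?I \<and> i \<star> a \<in> ?I" if "a \<in> A" "i \<in> ?I" for a i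
    proof -
      have "i \<in> A" using that(2) sub by blast
      then have "a \<star> i \<star> one = a \<star> i" "one \<star> i \<star> a = i \<star> a" using that(1) by simp_all
      then show ?thesis using wr[OF that(1) one_closed that(2)] wr[OF one_closed that] by simp
    qed
  qed
  moreover have "y \<in> ?I" using assms(1) by (intro CollectI exI[of _ "[(one, one)]"]) auto
  ultimately have "w \<in> ?I" using assms(2,3) by blast
  then show ?thesis by blast
qed

definition central :: "'a \<Rightarrow> bool" where
  "central z \<longleftrightarrow> z \<in> A \<and> (\<forall>a\<in>A. a \<star> z = z \<star> a)"

definition central_sandwich :: "('a \<times> 'a) list \<Rightarrow> bool" where
  "central_sandwich ps \<longleftrightarrow> set ps \<subseteq> A \<times> A \<and> (\<forall>c\<in>A. central (sandwich ps c))"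

text \<open>
  Among the nonzero operators take \<open>T\<close> with the largest kernel; composing \<open>T\<close> with an
  operator that moves one of its values to \<open>one\<close> keeps the kernel, so \<open>one\<close> may be assumed
  to be a value, say at \<open>c0\<close>. If some value of \<open>T\<close> did not commute with \<open>a\<close>, then
  \<open>c \<mapsto> a \<star> T c - T c \<star> a\<close> would be a nonzero operator whose kernel also contains \<open>c0\<close>,
  contrary to the choice of \<open>T\<close>.
\<close>

lemma central_sandwich_exists:
  assumes "y \<in> A" "y \<noteq> 0"
  shows "\<exists>ps. central_sandwich ps \<and> sandwich ps y = one"
proof -
  \<comment> \<open>The size of a kernel is measured by the independent sets in it.\<close>
  define Q where "Q K \<longleftrightarrow> independent K \<and> (\<exists>ps. set ps \<subseteq> A \<times> A \<and> (\<exists>c\<in>A. sandwich ps c \<noteq> 0) \<and>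
      K \<subseteq> {c \<in> A. sandwich ps c = 0})" for K
  obtain B where B: "finite B" "A \<subseteq> span B" using finite_dimensional by auto
  have bound: "finite K \<and> card K \<le> card B" if "Q K" for K
    using that B independent_span_bound[OF B(1), of K] unfolding Q_def by blast
  have "Q {}" unfolding Q_def using assms
    by (auto intro!: exI[of _ "[(one, one)]"] bexI[of _ y] simp: independent_empty)
  then obtain K where K: "Q K" "\<And>K'. Q K' \<Longrightarrow> card K' \<le> card K"
    using ex_has_greatest_nat[of Q "{}" card "Suc (card B)"] bound by (metis le_imp_less_Suc less_imp_le)
  then obtain ps c0 where ps: "set ps \<subseteq> A \<times> A" "c0 \<in> A" "sandwich ps c0 \<noteq> 0"
    "K \<subseteq> {c \<in> A. sandwich ps c = 0}" "independent K" unfolding Q_def by auto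
  obtain qs where qs: "set qs \<subseteq> A \<times> A" "sandwich qs (sandwich ps c0) = one"
    using sandwich_hits[of "sandwich ps c0" one] ps by auto
  obtain rs where rs: "set rs \<subseteq> A \<times> A" "\<And>c. c \<in> A \<Longrightarrow> sandwich rs c = sandwich qs (sandwich ps c)"
    using sandwich_compose[OF ps(1) qs(1)] by auto
  have central: "a \<star> sandwich rs c = sandwich rs c \<star> a" if a: "a \<in> A" and c: "c \<in> A" for a c
  proof (rule ccontr)
    assume ne: "a \<star> sandwich rs c \<noteq> sandwich rs c \<star> a"
    define ts where "ts = wrap a one rs @ wrap (- one) a rs"
    have ts: "set ts \<subseteq> A \<times> A" using wrap_closed[of a one rs] wrap_closed[of "- one" a rs] rs(1) a
      by (simp add: ts_def)
    have ts_eq: "sandwich ts d = a \<star> sandwich rs d - sandwich rs d \<star> a" if "d \<in> A" for d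
      using that rs(1) a by (simp add: ts_def sandwich_wrap mul_minus)
    have "insert c0 K \<subseteq> {c \<in> A. sandwich ts c = 0}"
      using ps ts_eq rs(2) qs(2) a by (auto simp: sandwich_zero[OF qs(1)])
    moreover have "c0 \<notin> span K"
      using span_minimal[OF ps(4) sandwich_kernel[OF ps(1)]] ps(3) by auto
    ultimately have "Q (insert c0 K)"
      unfolding Q_def using ts ts_eq[OF c] ne c ps(5)
      by (intro conjI exI[of _ ts] bexI[of _ c]) (auto simp: independent_insert)
    then have "card (insert c0 K) \<le> card K" by (rule K(2))
    then show False using \<open>c0 \<notin> span K\<close> bound[OF K(1)] span_base[of c0 K]
      by (auto simp: card_insert_if split: if_splits)
  qed
  obtain ss where ss: "set ss \<subseteq> A \<times> A" "sandwich ss y = c0"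
    using sandwich_hits[OF assms ps(2)] by auto
  obtain us where "set us \<subseteq> A \<times> A" "\<And>c. c \<in> A \<Longrightarrow> sandwich us c = sandwich rs (sandwich ss c)"
    using sandwich_compose[OF ss(1) rs(1)] by auto
  then show ?thesis using central ss rs(1) rs(2)[OF ps(2)] qs(2) assms
    by (intro exI[of _ us]) (auto simp: central_sandwich_def central_def)
qed

lemma sandwich_central_mul:
  assumes "set ps \<subseteq> A \<times> A" "central z" "c \<in> A"
  shows "sandwich ps (z \<star> c) = z \<star> sandwich ps c"
  using assms(1)
proof (induction ps)
  case Nil
  then show ?case using assms by (auto simp: central_def)
next
  case (Cons p ps)
  obtain u v where p: "p = (u, v)" by force
  then have uv: "u \<in> A" "v \<in> A" using Cons by auto
  have z: "z \<in> A" "u \<star> z = z \<star> u" using assms uv by (auto simp: central_def)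
  have "u \<star> (z \<star> c) \<star> v = (u \<star> z) \<star> (c \<star> v)" using uv z(1) assms(3) by (simp add: mul_assoc)
  also have "\<dots> = z \<star> (u \<star> c \<star> v)" unfolding z(2) using uv z(1) assms(3) by (simp add: mul_assoc)
  finally have "u \<star> (z \<star> c) \<star> v = z \<star> (u \<star> c \<star> v)" .
  then show ?case using Cons uv z assms p by (simp add: mul_add_right)
qed

text \<open>
  The hypothesis says that \<open>\<Sum> y\<^sub>i \<otimes> x\<^sub>i\<close> is killed by every central-valued operator on the
  first factor; over the centre these operators separate points, so the tensor is zero over
  the centre, and so is \<open>\<Sum> y\<^sub>i c x\<^sub>i\<close>. Elementary form: if \<open>y0 \<noteq> 0\<close>, a central-valued \<open>T\<close>
  with \<open>T y0 = one\<close> expresses \<open>x0\<close> by the other \<open>x\<^sub>i\<close> with the central coefficients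
  \<open>- T y\<^sub>i\<close>. Eliminating \<open>x0\<close> replaces \<open>y\<^sub>i\<close> by \<open>y\<^sub>i - T y\<^sub>i \<star> y0\<close> and shortens the list by
  one.
\<close>

lemma central_coefficients_vanish:
  assumes "set ps \<subseteq> A \<times> A"
    "\<And>us. central_sandwich us \<Longrightarrow> (\<Sum>(x, y)\<leftarrow>ps. sandwich us y \<star> x) = 0" and "c \<in> A"
  shows "(\<Sum>(x, y)\<leftarrow>ps. y \<star> c \<star> x) = 0"
  using assms(1,2)
proof (induction "length ps" arbitrary: ps)
  case 0
  then show ?case by simp
next
  case (Suc n)
  obtain x0 y0 qs where ps: "ps = (x0, y0) # qs" using Suc.hyps(2) by (cases ps) auto
  have cl: "x0 \<in> A" "y0 \<in> A" "set qs \<subseteq> A \<times> A" "n = length qs" using Suc ps by auto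
  show ?case
  proof (cases "y0 = 0")
    case True
    have "(\<Sum>(x, y)\<leftarrow>qs. sandwich us y \<star> x) = 0" if us: "central_sandwich us" for us
      using Suc.prems(2)[OF us] us cl True by (simp add: ps central_sandwich_def sandwich_zero)
    from Suc.hyps(1)[OF cl(4,3) this] show ?thesis using cl assms(3) True by (simp add: ps)
  next
    case False
    then obtain ts where ts: "central_sandwich ts" "sandwich ts y0 = one"
      using central_sandwich_exists cl by blast
    let ?z = "\<lambda>y. sandwich ts y"
    define rs where "rs = map (\<lambda>(x, y). (x, y - ?z y \<star> y0)) qs"
    have zc: "central (?z y)" if "y \<in> A" for y using that ts by (auto simp: central_sandwich_def)
    then have z: "?z y \<in> A" if "y \<in> A" for y using that by (auto simp: central_def)
    have rs: "set rs \<subseteq> A \<times> A" "n = length rs" using cl z by (auto simp: rs_def)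
    have x0: "x0 + (\<Sum>(x, y)\<leftarrow>qs. ?z y \<star> x) = 0" using Suc.prems(2)[OF ts(1)] ts cl by (simp add: ps)
    have sum_rs: "(\<Sum>(x, y)\<leftarrow>rs. G y x) = (\<Sum>(x, y)\<leftarrow>qs. G y x) - w \<star> (\<Sum>(x, y)\<leftarrow>qs. ?z y \<star> x)
        \<and> (\<Sum>(x, y)\<leftarrow>qs. ?z y \<star> x) \<in> A"
      if w: "w \<in> A" and G: "\<And>x y. x \<in> A \<Longrightarrow> y \<in> A \<Longrightarrow> G (y - ?z y \<star> y0) x = G y x - w \<star> (?z y \<star> x)"
      for G w
      using cl(3) unfolding rs_def
    proof (induction qs)
      case (Cons p qs)
      then show ?case using w z G by (cases p) (auto simp: mul_add_right)
    qed (use w in auto)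
    have x0': "w \<star> (\<Sum>(x, y)\<leftarrow>qs. ?z y \<star> x) = - (w \<star> x0)" if "w \<in> A" for w
      using x0 mul_minus(2)[OF that cl(1)] by (metis add_eq_0_iff)
    have "(\<Sum>(x, y)\<leftarrow>rs. sandwich us y \<star> x) = 0" if us: "central_sandwich us" for us
    proof -
      have us': "set us \<subseteq> A \<times> A" using us by (auto simp: central_sandwich_def)
      have "sandwich us (y - ?z y \<star> y0) \<star> x = sandwich us y \<star> x - sandwich us y0 \<star> (?z y \<star> x)"
        if "x \<in> A" "y \<in> A" for x y
      proof -
        have "sandwich us y0 \<star> (?z y \<star> x) = ?z y \<star> sandwich us y0 \<star> x"
          using zc[OF that(2)] z[OF that(2)] that cl us'
          by (simp add: mul_assoc[symmetric] central_def)
        then show ?thesis using that us' cl z zc by (simp add: sandwich_diff sandwich_central_mul mul_diff)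
      qed
      then have "(\<Sum>(x, y)\<leftarrow>rs. sandwich us y \<star> x) = (\<Sum>(x, y)\<leftarrow>qs. sandwich us y \<star> x)
          - sandwich us y0 \<star> (\<Sum>(x, y)\<leftarrow>qs. ?z y \<star> x)"
        using sum_rs[of "sandwich us y0" "\<lambda>y x. sandwich us y \<star> x"] us' cl by simp
      then show ?thesis using Suc.prems(2)[OF us] us' cl by (simp add: x0' ps add.commute)
    qed
    from Suc.hyps(1)[OF rs(2,1) this] have "(\<Sum>(x, y)\<leftarrow>rs. y \<star> c \<star> x) = 0" .
    moreover have "(y - ?z y \<star> y0) \<star> c \<star> x = y \<star> c \<star> x - y0 \<star> c \<star> (?z y \<star> x)" if "x \<in> A" "y \<in> A" for x y
    proof -
      have "y0 \<star> c \<star> ?z y = ?z y \<star> (y0 \<star> c)" using zc[OF that(2)] cl assms(3) by (simp add: central_def)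
      then have "y0 \<star> c \<star> (?z y \<star> x) = ?z y \<star> (y0 \<star> c) \<star> x"
        using z[OF that(2)] that cl assms(3) by (simp add: mul_assoc[symmetric])
      then show ?thesis using that z cl assms(3) by (simp add: mul_diff mul_assoc)
    qed
    ultimately have "(\<Sum>(x, y)\<leftarrow>qs. y \<star> c \<star> x) - y0 \<star> c \<star> (\<Sum>(x, y)\<leftarrow>qs. ?z y \<star> x) = 0"
      using sum_rs[of "y0 \<star> c" "\<lambda>y x. y \<star> c \<star> x"] cl assms(3) by simp
    then show ?thesis using cl assms(3) by (simp add: x0' ps add.commute)
  qed
qed

text \<open>
  For a central-valued operator \<open>U c = \<Sum> p\<^sub>j c q\<^sub>j\<close>, the hypothesis with \<open>c = p\<^sub>j\<close>,
  multiplied by \<open>q\<^sub>j\<close> and summed over \<open>j\<close>, gives \<open>\<Sum> x\<^sub>i U(y\<^sub>i) = 0\<close>. As \<open>U(y\<^sub>i)\<close> is central,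
  the previous lemma applies.
\<close>

lemma sandwich_swap_eq_0:
  assumes ps: "set ps \<subseteq> A \<times> A" and zero: "\<And>c. c \<in> A \<Longrightarrow> sandwich ps c = 0" and "c \<in> A"
  shows "sandwich (map prod.swap ps) c = 0"
proof -
  have "(\<Sum>(x, y)\<leftarrow>ps. sandwich us y \<star> x) = 0" if us: "central_sandwich us" for us
  proof -
    have "set us \<subseteq> A \<times> A" using us by (simp add: central_sandwich_def)
    then have expand: "(\<Sum>(x, y)\<leftarrow>ps. x \<star> sandwich us y) = (\<Sum>(p, q)\<leftarrow>us. sandwich ps p \<star> q)"
    proof (induction us)
      case Nil
      show ?case using ps by (induction ps) auto
    next
      case (Cons u us)
      obtain p q where u: "u = (p, q)" "p \<in> A" "q \<in> A" "set us \<subseteq> A \<times> A" using Cons.prems by (cases u) auto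
      have "(\<Sum>(x, y)\<leftarrow>ps. x \<star> sandwich (u # us) y) = sandwich ps p \<star> q + (\<Sum>(x, y)\<leftarrow>ps. x \<star> sandwich us y)"
        using ps u by (induction ps) (auto simp: mul_add_left mul_add_right mul_assoc add.assoc add.left_commute)
      then show ?case using Cons u by simp
    qed
    have "(\<Sum>(x, y)\<leftarrow>ps. sandwich us y \<star> x) = (\<Sum>(x, y)\<leftarrow>ps. x \<star> sandwich us y)"
      using ps us by (intro arg_cong[of _ _ sum_list] map_cong) (auto simp: central_sandwich_def central_def)
    also have "\<dots> = (\<Sum>(p, q)\<leftarrow>us. 0)" unfolding expand
      using zero \<open>set us \<subseteq> A \<times> A\<close> by (intro arg_cong[of _ _ sum_list] map_cong) auto
    also have "\<dots> = 0" by (induction us) auto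
    finally show ?thesis .
  qed
  from central_coefficients_vanish[OF ps this \<open>c \<in> A\<close>] show ?thesis
    by (simp add: sandwich_def comp_def case_prod_unfold)
qed

text \<open>
  The reverse of a nonzero central-valued operator is nonzero and vanishes on commutators,
  so the commutators lie in a proper subspace.
\<close>

theorem trace_exists:
  "\<exists>\<tau>. Vector_Spaces.linear sc (*) \<tau> \<and> (\<forall>a\<in>A. \<forall>b\<in>A. \<tau> (a \<star> b) = \<tau> (b \<star> a)) \<and> (\<exists>a\<in>A. \<tau> a \<noteq> 0)"
proof -
  obtain y where y: "y \<in> A" "y \<noteq> 0" using nontrivial carrier_closed(1) by blast
  then obtain ps where ps: "central_sandwich ps" "sandwich ps y = one"
    using central_sandwich_exists by blast
  have cl: "set ps \<subseteq> A \<times> A" using ps by (simp add: central_sandwich_def)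
  let ?sw = "map prod.swap ps"
  have swcl: "set ?sw \<subseteq> A \<times> A" using cl by auto
  have comm: "sandwich ?sw (c \<star> a) = sandwich ?sw (a \<star> c)" if a: "a \<in> A" and c: "c \<in> A" for a c
  proof -
    \<comment> \<open>Presents \<open>c \<mapsto> a \<star> T c - T c \<star> a\<close>, which is zero.\<close>
    let ?rs = "wrap a one ps @ wrap (- one) a ps"
    have "sandwich ?rs d = 0" if "d \<in> A" for d
      using that ps cl a by (simp add: sandwich_wrap mul_minus central_sandwich_def central_def)
    then have "sandwich (map prod.swap ?rs) c = 0"
      using wrap_closed[of a one ps] wrap_closed[of "- one" a ps] cl a c
      by (intro sandwich_swap_eq_0) auto
    moreover have "sandwich (map prod.swap ?rs) c = sandwich ?sw (c \<star> a) - sandwich ?sw (a \<star> c)"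
      using cl a c unfolding wrap_def
      by (induction ps) (auto simp: mul_assoc mul_minus algebra_simps)
    ultimately show ?thesis by simp
  qed
  have "\<exists>c\<in>A. sandwich ?sw c \<noteq> 0"
  proof (rule ccontr)
    assume "\<not> ?thesis"
    \<comment> \<open>Reversing twice gives back an operator that takes the value \<open>one\<close>.\<close>
    then have "sandwich (map prod.swap ?sw) y = 0" by (intro sandwich_swap_eq_0[OF swcl _ y(1)]) blast
    then have "one = 0" using ps(2) by (simp add: comp_def)
    then show False using y by (metis mul_zero(1) one_mul)
  qed
  then obtain c where c: "c \<in> A" "sandwich ?sw c \<noteq> 0" by auto
  \<comment> \<open>The reversed operator vanishes on \<open>U\<close> but not at \<open>c\<close>.\<close>
  define U where "U = span {a \<star> b - b \<star> a | a b. a \<in> A \<and> b \<in> A}"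
  have "U \<subseteq> {c \<in> A. sandwich ?sw c = 0}" unfolding U_def
    by (rule span_minimal[OF _ sandwich_kernel[OF swcl]]) (auto simp: sandwich_diff[OF swcl] comm)
  then have "c \<notin> U" using c by auto
  from separating_functional[OF vector_space_axioms _ this]
  obtain \<tau> where \<tau>: "Vector_Spaces.linear sc (*) \<tau>" "\<tau> c = 1" "\<And>u. u \<in> U \<Longrightarrow> \<tau> u = 0"
    by (auto simp: U_def)
  interpret \<tau>: Vector_Spaces.linear sc "(*)" \<tau> by (rule \<tau>)
  have "\<tau> (a \<star> b) = \<tau> (b \<star> a)" if "a \<in> A" "b \<in> A" for a b
  proof -
    have "a \<star> b - b \<star> a \<in> U" unfolding U_def using that by (intro span_base) auto
    then show ?thesis using \<tau>(3) \<tau>.diff by force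
  qed
  then show ?thesis using \<tau>(1,2) c(1) by (intro exI[of _ \<tau>]) (auto intro!: bexI[of _ c])
qed

end

section \<open>The convolution algebra and its actions on the coalgebra\<close>

lemma vector_space_field: "vector_space ((*) :: 'k::field \<Rightarrow> 'k \<Rightarrow> 'k)"
  by unfold_locales (simp_all add: algebra_simps)

lemma tensor_class_self: "t \<in> tensor_class scale S t"
  by (simp add: tensor_class_def tensor_relations_def free_vs.span_zero)

lemma tensor_class_eq_iff:
  "tensor_class scale S s = tensor_class scale S t \<longleftrightarrow> s - t \<in> tensor_relations scale S"
proof
  assume "tensor_class scale S s = tensor_class scale S t"
  then show "s - t \<in> tensor_relations scale S"
    using tensor_class_self[of s scale S] by (simp add: tensor_class_def)
next
  assume *: "s - t \<in> tensor_relations scale S"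
  have "u - s \<in> tensor_relations scale S \<longleftrightarrow> u - t \<in> tensor_relations scale S" for u
    using free_vs.span_add[of "u - s" _ "s - t"] free_vs.span_diff[of "u - t" _ "s - t"] *
    by (auto simp: tensor_relations_def)
  then show "tensor_class scale S s = tensor_class scale S t" by (auto simp: tensor_class_def)
qed

lemma linear_formal_eval:
  assumes "Vector_Spaces.linear sm sm' h"
  shows "h (formal_eval sm B t) = formal_eval sm' (\<lambda>a b. h (B a b)) t"
proof -
  interpret Vector_Spaces.linear sm sm' h by fact
  show ?thesis by (simp add: formal_eval_def sum scale)
qed

text \<open>
  The linear extension to formal combinations of triples; with
  \<open>h (p, q, r) = f p * g q * h r\<close> it factors through \<open>C \<otimes> C \<otimes> C\<close> and turns coassociativity
  into associativity of the convolution product.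
\<close>

definition eval3 :: "('c \<times> 'c \<times> 'c \<Rightarrow> 'k::field) \<Rightarrow> ('c \<times> 'c \<times> 'c \<Rightarrow>\<^sub>0 'k) \<Rightarrow> 'k" where
  "eval3 h u = (\<Sum>p\<in>Poly_Mapping.keys u. Poly_Mapping.lookup u p * h p)"

lemma eval3_superset:
  assumes "finite S" "Poly_Mapping.keys u \<subseteq> S"
  shows "eval3 h u = (\<Sum>p\<in>S. Poly_Mapping.lookup u p * h p)"
  unfolding eval3_def by (rule sum.mono_neutral_left[OF assms]) (auto simp: in_keys_iff)

lemma eval3_linear:
  fixes h :: "'c \<times> 'c \<times> 'c \<Rightarrow> 'k::field"
  shows "Vector_Spaces.linear free_scale (*) (eval3 h)"
  unfolding Vector_Spaces.linear_iff
proof (intro conjI allI)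
  fix s t :: "'c \<times> 'c \<times> 'c \<Rightarrow>\<^sub>0 'k" and c
  let ?S = "Poly_Mapping.keys s \<union> Poly_Mapping.keys t \<union> Poly_Mapping.keys (s + t)"
  have "eval3 h u = (\<Sum>p\<in>?S. Poly_Mapping.lookup u p * h p)" if "u \<in> {s, t, s + t}" for u
    using that by (intro eval3_superset) auto
  then show "eval3 h (s + t) = eval3 h s + eval3 h t"
    by (simp add: lookup_add distrib_right sum.distrib)
  have "Poly_Mapping.keys (free_scale c s) \<subseteq> Poly_Mapping.keys s"
    by (auto simp: in_keys_iff lookup_free_scale)
  then show "eval3 h (free_scale c s) = c * eval3 h s"
    by (subst eval3_superset[of "Poly_Mapping.keys s"])
      (simp_all add: lookup_free_scale eval3_def sum_distrib_left mult.assoc)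
qed (intro free_vs.vector_space_axioms vector_space_field)+

lemma eval3_single: "eval3 h (Poly_Mapping.single p c) = c * h p"
  by (subst eval3_superset[of "{p}"]) auto

context coalgebra
begin

lemma linearI:
  assumes "vector_space sm" "\<And>x y. h (x + y) = h x + h y" "\<And>c x. h (scale c x) = sm c (h x)"
  shows "Vector_Spaces.linear scale sm h"
  using assms vector_space_axioms by (simp add: Vector_Spaces.linear_iff)

lemma dual_iff: "f \<in> dual \<longleftrightarrow> (\<forall>x y. f (x + y) = f x + f y) \<and> (\<forall>c x. f (scale c x) = c * f x)"
  using vector_space_axioms vector_space_field by (auto simp: dual_def Vector_Spaces.linear_iff)

lemma dual_add: "f \<in> dual \<Longrightarrow> f (x + y) = f x + f y"
  and dual_scale: "f \<in> dual \<Longrightarrow> f (scale c x) = c * f x"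
  by (auto simp: dual_iff)

lemma dual_zero: "f \<in> dual \<Longrightarrow> f 0 = 0"
  using dual_scale[of f 0 0] by simp

lemma dual_diff: "f \<in> dual \<Longrightarrow> f (x - y) = f x - f y"
  using dual_add[of f "x - y" y] by simp

lemma dual_eqI:
  assumes "\<And>f. f \<in> dual \<Longrightarrow> f x = f y"
  shows "x = y"
proof (rule ccontr)
  assume "x \<noteq> y"
  then obtain f where "Vector_Spaces.linear scale (*) f" "f (x - y) = 1"
    using separating_functional[OF vector_space_axioms subspace_single_0, of "x - y"] by auto
  then show False using assms[of f] dual_diff[of f x y] by (simp add: dual_def)
qed

lemma counit_dual: "\<epsilon> \<in> dual"
  using counit_linear by (simp add: dual_def)

lemma sweedler_comult:
  assumes "vector_space sm" "\<And>b. Vector_Spaces.linear scale sm (\<lambda>a. B a b)"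
    "\<And>a. Vector_Spaces.linear scale sm (B a)" "t \<in> \<Delta> x"
  shows "sweedler sm B (\<Delta> x) = formal_eval sm B t"
proof -
  obtain s where s: "\<Delta> x = tensor2 scale s" using comult_tensor by auto
  then have "\<Delta> x = tensor2 scale t"
    using assms(4) tensor_class_eq_iff[of scale slots2 t s] by (simp add: tensor_class_def)
  then show ?thesis using sweedler_tensor2[OF assms(1-3)] by simp
qed

lemma comult_nonempty: "\<exists>t. t \<in> \<Delta> x"
  using comult_tensor[of x] tensor_class_self by blast

lemma sweedler_comult_linear:
  assumes "vector_space sm" "\<And>b. Vector_Spaces.linear scale sm (\<lambda>a. B a b)"
    "\<And>a. Vector_Spaces.linear scale sm (B a)"
  shows "Vector_Spaces.linear scale sm (\<lambda>x. sweedler sm B (\<Delta> x))"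
proof (rule linearI[OF assms(1)])
  interpret ev: Vector_Spaces.linear free_scale sm "formal_eval sm B"
    by (rule formal_eval_linear[OF assms(1)])
  note rep = sweedler_comult[OF assms]
  show "sweedler sm B (\<Delta> (x + y)) = sweedler sm B (\<Delta> x) + sweedler sm B (\<Delta> y)" for x y
  proof -
    obtain s t where st: "s \<in> \<Delta> x" "t \<in> \<Delta> y" using comult_nonempty by metis
    then have "s + t \<in> \<Delta> (x + y)" using comult_add tensor_class_self by metis
    then show ?thesis using rep st by (simp add: ev.add)
  qed
  show "sweedler sm B (\<Delta> (scale c x)) = sm c (sweedler sm B (\<Delta> x))" for c x
  proof -
    obtain t where t: "t \<in> \<Delta> x" using comult_nonempty by metis
    then have "free_scale c t \<in> \<Delta> (scale c x)" using comult_scale tensor_class_self by metis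
    then show ?thesis using rep t by (simp add: ev.scale)
  qed
qed

lemma bilinear_scalings:
  assumes "f \<in> dual"
  shows "Vector_Spaces.linear scale scale (\<lambda>a. scale (f b) a)"
    "Vector_Spaces.linear scale scale (\<lambda>b. scale (f b) a)"
  using assms by (auto intro!: linearI[OF vector_space_axioms] simp: dual_iff algebra_simps)

lemma bilinear_products:
  assumes "f \<in> dual" "g \<in> dual"
  shows "Vector_Spaces.linear scale (*) (\<lambda>a. f a * g b)"
    "Vector_Spaces.linear scale (*) (\<lambda>b. f a * g b)"
  using assms by (auto intro!: linearI[OF vector_space_field] simp: dual_iff algebra_simps)

lemma left_act_rep:
  "f \<in> dual \<Longrightarrow> t \<in> \<Delta> x \<Longrightarrow> left_act f x = formal_eval scale (\<lambda>a b. scale (f b) a) t"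
  unfolding left_act_def by (intro sweedler_comult bilinear_scalings vector_space_axioms)

lemma right_act_rep:
  "f \<in> dual \<Longrightarrow> t \<in> \<Delta> x \<Longrightarrow> right_act x f = formal_eval scale (\<lambda>a b. scale (f a) b) t"
  unfolding right_act_def by (intro sweedler_comult bilinear_scalings vector_space_axioms)

lemma convolution_rep:
  "f \<in> dual \<Longrightarrow> g \<in> dual \<Longrightarrow> t \<in> \<Delta> x \<Longrightarrow> convolution f g x = formal_eval (*) (\<lambda>a b. f a * g b) t"
  unfolding convolution_def by (intro sweedler_comult bilinear_products vector_space_field)

lemma left_act_linear: "f \<in> dual \<Longrightarrow> Vector_Spaces.linear scale scale (left_act f)"
  unfolding left_act_def by (intro sweedler_comult_linear bilinear_scalings vector_space_axioms)

lemma right_act_linear: "f \<in> dual \<Longrightarrow> Vector_Spaces.linear scale scale (\<lambda>x. right_act x f)"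
  unfolding right_act_def by (intro sweedler_comult_linear bilinear_scalings vector_space_axioms)

lemma convolution_dual: "f \<in> dual \<Longrightarrow> g \<in> dual \<Longrightarrow> convolution f g \<in> dual"
  unfolding convolution_def[abs_def] dual_def[THEN eqset_imp_iff] mem_Collect_eq
  by (intro sweedler_comult_linear bilinear_products vector_space_field) (simp_all add: dual_def)

text \<open>
  With \<open>dual_eqI\<close>, this and its counterpart for the right action reduce every identity
  between the actions to one in the convolution algebra.
\<close>

lemma dual_left_act:
  assumes "f \<in> dual" "g \<in> dual"
  shows "f (left_act g x) = convolution f g x"
proof -
  obtain t where "t \<in> \<Delta> x" using comult_nonempty by metis
  moreover have "Vector_Spaces.linear scale (*) f" using assms by (simp add: dual_def)
  ultimately show ?thesis
    by (simp add: left_act_rep[OF assms(2)] convolution_rep[OF assms] linear_formal_eval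
        dual_scale[OF assms(1)] mult.commute)
qed

lemma dual_right_act:
  assumes "f \<in> dual" "g \<in> dual"
  shows "g (right_act x f) = convolution f g x"
proof -
  obtain t where "t \<in> \<Delta> x" using comult_nonempty by metis
  moreover have "Vector_Spaces.linear scale (*) g" using assms by (simp add: dual_def)
  ultimately show ?thesis
    by (simp add: right_act_rep[OF assms(1)] convolution_rep[OF assms] linear_formal_eval
        dual_scale[OF assms(2)] mult.commute)
qed

lemma convolution_assoc:
  assumes "f \<in> dual" "g \<in> dual" "h \<in> dual"
  shows "convolution (convolution f g) h = convolution f (convolution g h)"
proof
  fix x
  define G where "G = (\<lambda>(p, q, r). f p * g q * h r)"
  interpret G: Vector_Spaces.linear free_scale "(*)" "eval3 G" by (rule eval3_linear)
  have slot: "G (k (a + b)) = G (k a) + G (k b)" "G (k (scale c a)) = c * G (k a)"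
    if "k \<in> slots3" for k a b c
  proof -
    from that consider y z where "k = (\<lambda>a. (a, y, z))" | y z where "k = (\<lambda>a. (y, a, z))"
      | y z where "k = (\<lambda>a. (y, z, a))" by (auto simp: slots3_def)
    then show "G (k (a + b)) = G (k a) + G (k b)" "G (k (scale c a)) = c * G (k a)"
      by (cases; simp only: G_def prod.case assms[THEN dual_add] assms[THEN dual_scale] distrib_left distrib_right
        mult.assoc mult.left_commute)+
  qed
  have zero: "eval3 G u = 0" if "u \<in> tensor_relations scale slots3" for u
    using that unfolding tensor_relations_def
  proof (rule free_vs.span_induct)
    show "free_vs.subspace {u. eval3 G u = 0}" by (rule G.subspace_kernel)
  qed (auto simp: G.diff G.scale eval3_single slot)
  \<comment> \<open>The inner and outer sums are formed from chosen representatives, so only linearity of the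
    evaluation on formal combinations is available here.\<close>
  have push: "eval3 G (sweedler free_scale B T) = sweedler (*) (\<lambda>a b. eval3 G (B a b)) T" for B T
    by (simp add: sweedler_def linear_formal_eval[OF eval3_linear])
  let ?L = "sweedler free_scale
      (\<lambda>a b. sweedler free_scale (\<lambda>p q. Poly_Mapping.single (p, q, b) (1::'k)) (\<Delta> a)) (\<Delta> x)"
  let ?R = "sweedler free_scale
      (\<lambda>a b. sweedler free_scale (\<lambda>p q. Poly_Mapping.single (a, p, q) (1::'k)) (\<Delta> b)) (\<Delta> x)"
  have "?L - ?R \<in> tensor_relations scale slots3"
    using coassoc[of x] by (simp add: tensor_class_eq_iff)
  then have "eval3 G ?L = eval3 G ?R" using zero[of "?L - ?R"] by (simp add: G.diff)
  moreover have "sweedler (*) (\<lambda>p q. f p * g q * c) T = sweedler (*) (\<lambda>p q. f p * g q) T * c" for c T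
    unfolding sweedler_def formal_eval_def sum_distrib_right by (rule sum.cong; simp)
  then have "eval3 G ?L = convolution (convolution f g) h x"
    unfolding push eval3_single by (simp only: G_def prod.case convolution_def mult_1_left)
  moreover have "sweedler (*) (\<lambda>p q. c * g p * h q) T = c * sweedler (*) (\<lambda>p q. g p * h q) T" for c T
    unfolding sweedler_def formal_eval_def sum_distrib_left by (rule sum.cong; simp)
  then have "eval3 G ?R = convolution f (convolution g h) x"
    unfolding push eval3_single by (simp only: G_def prod.case convolution_def mult_1_left)
  ultimately show "convolution (convolution f g) h x = convolution f (convolution g h) x" by simp
qed

lemma left_act_counit [simp]: "left_act \<epsilon> x = x"
  and right_act_counit [simp]: "right_act x \<epsilon> = x"
  using counit_right counit_left by (simp_all add: left_act_def right_act_def)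

lemma left_act_left_act:
  "f \<in> dual \<Longrightarrow> g \<in> dual \<Longrightarrow> left_act f (left_act g x) = left_act (convolution f g) x"
  by (rule dual_eqI) (simp add: dual_left_act convolution_dual convolution_assoc)

lemma right_act_right_act:
  "f \<in> dual \<Longrightarrow> g \<in> dual \<Longrightarrow> right_act (right_act x f) g = right_act x (convolution f g)"
  by (rule dual_eqI) (simp add: dual_right_act convolution_dual convolution_assoc)

lemma left_act_right_act:
  assumes "f \<in> dual" "g \<in> dual"
  shows "left_act f (right_act x g) = right_act (left_act f x) g"
proof (rule dual_eqI)
  fix h assume "h \<in> dual"
  with assms show "h (left_act f (right_act x g)) = h (right_act (left_act f x) g)"
    by (simp add: dual_left_act dual_right_act convolution_dual convolution_assoc)
qed

lemma dual_closed:
  "f \<in> dual \<Longrightarrow> g \<in> dual \<Longrightarrow> f + g \<in> dual" "f \<in> dual \<Longrightarrow> g \<in> dual \<Longrightarrow> f - g \<in> dual"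
  "f \<in> dual \<Longrightarrow> (\<lambda>x. c * f x) \<in> dual" "0 \<in> dual"
  by (auto simp: dual_iff algebra_simps)

lemma dual_left_act_right_act: "h \<in> dual \<Longrightarrow> f \<in> dual \<Longrightarrow> h (left_act f x) = f (right_act x h)"
  by (simp add: dual_left_act dual_right_act)

lemma left_act_add: "f \<in> dual \<Longrightarrow> g \<in> dual \<Longrightarrow> left_act (f + g) x = left_act f x + left_act g x"
  by (rule dual_eqI)
    (simp add: dual_left_act_right_act dual_closed dual_add[of h for h :: "'c \<Rightarrow> 'k"])

lemma left_act_diff: "f \<in> dual \<Longrightarrow> g \<in> dual \<Longrightarrow> left_act (f - g) x = left_act f x - left_act g x"
  by (rule dual_eqI)
    (simp add: dual_left_act_right_act dual_closed dual_diff[of h for h :: "'c \<Rightarrow> 'k"])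

lemma left_act_scale: "f \<in> dual \<Longrightarrow> left_act (\<lambda>x. c * f x) x = scale c (left_act f x)"
  by (rule dual_eqI) (simp add: dual_left_act_right_act dual_closed dual_scale)

lemma left_act_zero: "left_act 0 x = 0"
  by (rule dual_eqI) (simp add: dual_left_act_right_act dual_closed dual_zero)

section \<open>Subcoalgebras as sub-bimodules\<close>

definition bisubmodule :: "'c set \<Rightarrow> bool" where
  "bisubmodule E \<longleftrightarrow> subspace E \<and> (\<forall>f\<in>dual. \<forall>x\<in>E. left_act f x \<in> E \<and> right_act x f \<in> E)"

lemma bisubmodule_span:
  assumes "\<And>f x. f \<in> dual \<Longrightarrow> x \<in> S \<Longrightarrow> left_act f x \<in> span S \<and> right_act x f \<in> span S"
  shows "bisubmodule (span S)"
proof -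
  have "left_act f x \<in> span S \<and> right_act x f \<in> span S" if f: "f \<in> dual" and x: "x \<in> span S" for f x
  proof -
    interpret l: Vector_Spaces.linear scale scale "left_act f" by (rule left_act_linear[OF f])
    interpret r: Vector_Spaces.linear scale scale "\<lambda>x. right_act x f" by (rule right_act_linear[OF f])
    have "span S \<subseteq> left_act f -` span S \<inter> (\<lambda>x. right_act x f) -` span S"
      using assms f by (intro span_minimal subspace_inter l.subspace_vimage r.subspace_vimage) auto
    then show ?thesis using x by blast
  qed
  then show ?thesis by (simp add: bisubmodule_def)
qed

lemma subcoalgebra_imp_bisubmodule:
  assumes "subcoalgebra E"
  shows "bisubmodule E"
  unfolding bisubmodule_def
proof (intro conjI ballI)
  show sub: "subspace E" using assms by (simp add: subcoalgebra_def)
  fix f x assume f: "f \<in> dual" and x: "x \<in> E"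
  then obtain t where "Poly_Mapping.keys t \<subseteq> E \<times> E" "t \<in> \<Delta> x"
    using assms tensor_class_self unfolding subcoalgebra_def by metis
  then show "left_act f x \<in> E" "right_act x f \<in> E"
    using f by (auto simp: left_act_rep right_act_rep formal_eval_def
        intro!: subspace_sum[OF sub] subspace_scale[OF sub])
qed

text \<open>
  If \<open>u\<close> were nonzero in \<open>C \<otimes> C\<close>, some bilinear form \<open>\<beta>\<close> would not vanish on it. Expanding
  second components in a basis gives \<open>\<beta>(u) = \<Sum>\<^sub>e \<beta>(u\<^sub>e, e)\<close>, where \<open>u\<^sub>e\<close> is the contraction
  of \<open>u\<close> with the coordinate functional of \<open>e\<close>, and all \<open>u\<^sub>e\<close> vanish.
\<close>

lemma tensor_relations_if_contractions_vanish:
  assumes "\<And>g. g \<in> dual \<Longrightarrow> formal_eval scale (\<lambda>a b. scale (g b) a) u = 0"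
  shows "u \<in> tensor_relations scale slots2"
proof (rule ccontr)
  assume "u \<notin> tensor_relations scale slots2"
  from separating_functional[OF free_vs.vector_space_axioms _ this]
  obtain \<Phi> where \<Phi>: "Vector_Spaces.linear free_scale (*) \<Phi>" "\<Phi> u = 1"
    "\<And>v. v \<in> tensor_relations scale slots2 \<Longrightarrow> \<Phi> v = 0"
    by (auto simp: tensor_relations_def)
  interpret \<Phi>: Vector_Spaces.linear free_scale "(*)" \<Phi> by (rule \<Phi>)
  define \<beta> where "\<beta> a b = \<Phi> (Poly_Mapping.single (a, b) 1)" for a b
  have rel: "\<Phi> (Poly_Mapping.single (h (a + b)) 1) = \<Phi> (Poly_Mapping.single (h a) 1) + \<Phi> (Poly_Mapping.single (h b) 1)"
    "\<Phi> (Poly_Mapping.single (h (scale c a)) 1) = c * \<Phi> (Poly_Mapping.single (h a) 1)"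
    if "h \<in> slots2" for h :: "'c \<Rightarrow> 'c \<times> 'c" and a b c
  proof -
    have "Poly_Mapping.single (h (a + b)) 1 - Poly_Mapping.single (h a) 1 - Poly_Mapping.single (h b) 1
        \<in> tensor_relations scale slots2"
      and "Poly_Mapping.single (h (scale c a)) 1 - free_scale c (Poly_Mapping.single (h a) 1)
        \<in> tensor_relations scale slots2"
      unfolding tensor_relations_def
      by (rule free_vs.span_base, use that in blast)+
    from this[THEN \<Phi>(3)] show "\<Phi> (Poly_Mapping.single (h (a + b)) 1) = \<Phi> (Poly_Mapping.single (h a) 1) + \<Phi> (Poly_Mapping.single (h b) 1)"
    "\<Phi> (Poly_Mapping.single (h (scale c a)) 1) = c * \<Phi> (Poly_Mapping.single (h a) 1)"
      by (simp_all add: \<Phi>.diff \<Phi>.scale diff_eq_eq add.commute)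
  qed
  have lin1: "Vector_Spaces.linear scale (*) (\<lambda>a. \<beta> a b)" for b
  proof -
    have "(\<lambda>a. (a, b)) \<in> slots2" by (auto simp: slots2_def)
    from rel[OF this] show ?thesis by (intro linearI[OF vector_space_field]) (simp_all add: \<beta>_def)
  qed
  have lin2: "Vector_Spaces.linear scale (*) (\<lambda>b. \<beta> a b)" for a
  proof -
    have "(\<lambda>b. (a, b)) \<in> slots2" by (auto simp: slots2_def)
    from rel[OF this] show ?thesis by (intro linearI[OF vector_space_field]) (simp_all add: \<beta>_def)
  qed
  let ?K = "Poly_Mapping.keys u" and ?c = "Poly_Mapping.lookup u"
  have "u = (\<Sum>p\<in>?K. free_scale (?c p) (Poly_Mapping.single p 1))"
    by (rule poly_mapping_eqI)
      (simp add: lookup_sum lookup_free_scale lookup_single when_def in_keys_iff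
        if_distrib[of "\<lambda>x. _ * x"] sum.delta cong: if_cong)
  then have "\<Phi> u = (\<Sum>p\<in>?K. ?c p * \<Phi> (Poly_Mapping.single p 1))"
    by (metis (no_types, lifting) \<Phi>.sum \<Phi>.scale sum.cong)
  then have u: "\<Phi> u = (\<Sum>p\<in>?K. ?c p * \<beta> (fst p) (snd p))" by (simp add: \<beta>_def)
  define B where "B = extend_basis {}"
  have B: "independent B" "span B = UNIV"
    using independent_extend_basis[OF independent_empty] span_extend_basis[OF independent_empty]
    by (auto simp: B_def)
  define F where "F = (\<Union>p\<in>?K. {e. representation B (snd p) e \<noteq> 0})"
  have F: "finite F" by (simp add: F_def finite_representation)
  have expand: "\<beta> (fst p) (snd p) = (\<Sum>e\<in>F. representation B (snd p) e * \<beta> (fst p) e)" if p: "p \<in> ?K" for p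
  proof -
    interpret R: Vector_Spaces.linear scale "(*)" "\<beta> (fst p)" by (rule lin2)
    have "snd p = (\<Sum>e | representation B (snd p) e \<noteq> 0. scale (representation B (snd p) e) e)"
      using B by (simp add: sum_nonzero_representation_eq)
    also have "\<dots> = (\<Sum>e\<in>F. scale (representation B (snd p) e) e)"
      using p F by (intro sum.mono_neutral_left) (auto simp: F_def)
    finally show ?thesis by (metis (no_types, lifting) R.sum R.scale sum.cong)
  qed
  have "\<Phi> u = (\<Sum>p\<in>?K. \<Sum>e\<in>F. ?c p * (representation B (snd p) e * \<beta> (fst p) e))"
    unfolding u by (rule sum.cong) (simp_all add: expand sum_distrib_left)
  also have "\<dots> = (\<Sum>e\<in>F. \<Sum>p\<in>?K. ?c p * (representation B (snd p) e * \<beta> (fst p) e))"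
    by (rule sum.swap)
  also have "\<dots> = (\<Sum>e\<in>F. 0)"
  proof (rule sum.cong[OF refl])
    fix e
    interpret L: Vector_Spaces.linear scale "(*)" "\<lambda>a. \<beta> a e" by (rule lin1)
    have "(\<lambda>v. representation B v e) \<in> dual"
      using linear_representation[OF B] by (simp add: dual_def)
    from assms[OF this] have "\<beta> (formal_eval scale (\<lambda>a b. scale (representation B b e) a) u) e = 0"
      by (simp add: L.zero)
    then show "(\<Sum>p\<in>?K. ?c p * (representation B (snd p) e * \<beta> (fst p) e)) = 0"
      by (simp add: formal_eval_def L.sum L.scale)
  qed
  finally show False using \<Phi>(2) by simp
qed

text \<open>
  The projection along \<open>W\<close> transports functionals on a summand of \<open>C\<close> to functionals on \<open>C\<close>
  that vanish on the other summands.
\<close>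

lemma projection_exists:
  assumes "subspace U" "subspace W" "U \<inter> W = {0}" "\<And>x. \<exists>u\<in>U. x - u \<in> W"
  shows "\<exists>P. Vector_Spaces.linear scale scale P \<and> (\<forall>x. P x \<in> U) \<and> (\<forall>u\<in>U. P u = u) \<and> (\<forall>w\<in>W. P w = 0)"
proof -
  obtain P where P: "\<And>x. P x \<in> U" "\<And>x. x - P x \<in> W" using assms(4) by metis
  have uniq: "P x = u" if "u \<in> U" "x - u \<in> W" for x u
  proof -
    have "P x - u \<in> U" using P that assms by (intro subspace_diff) auto
    moreover have "(x - u) - (x - P x) \<in> W" by (intro subspace_diff[OF assms(2)] P that(2))
    then have "P x - u \<in> W" by (simp add: algebra_simps)
    ultimately have "P x - u \<in> {0}" using assms(3) by blast
    then show ?thesis by simp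
  qed
  have "Vector_Spaces.linear scale scale P"
  proof (rule linearI[OF vector_space_axioms])
    fix x y c
    have "(x - P x) + (y - P y) \<in> W" "scale c (x - P x) \<in> W" using P assms
      by (auto intro: subspace_add subspace_scale)
    then show "P (x + y) = P x + P y" "P (scale c x) = scale c (P x)" using P assms
      by (auto intro!: uniq intro: subspace_add subspace_scale simp: algebra_simps)
  qed
  moreover have "P u = u" if "u \<in> U" for u using that assms by (intro uniq) (auto intro: subspace_0)
  moreover have "P w = 0" if "w \<in> W" for w using that assms by (intro uniq) (auto intro: subspace_0)
  ultimately show ?thesis using P by blast
qed

text \<open>
  With a linear projection \<open>P\<close> onto \<open>E\<close>, a representative \<open>t\<close> of \<open>\<Delta> x\<close> can be replaced by
  \<open>(P \<otimes> P) t\<close>: both have the same contractions \<open>g \<cdot> x\<close>, because \<open>g \<cdot> x\<close> and \<open>x \<cdot> f\<close> lie in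
  \<open>E\<close>, where \<open>P\<close> is the identity.
\<close>

lemma bisubmodule_imp_subcoalgebra:
  assumes "bisubmodule E"
  shows "subcoalgebra E"
  unfolding subcoalgebra_def
proof (intro conjI ballI)
  show sub: "subspace E" using assms by (simp add: bisubmodule_def)
  interpret vp: vector_space_pair scale scale by unfold_locales
  obtain P where P: "Vector_Spaces.linear scale scale P" "\<And>x. P x \<in> E" "\<And>x. x \<in> E \<Longrightarrow> P x = x"
    using vp.linear_exists_left_inverse_on[OF linear_id sub] by auto
  interpret P: Vector_Spaces.linear scale scale P by (rule P)
  fix x assume x: "x \<in> E"
  obtain t where t: "t \<in> \<Delta> x" using comult_nonempty by metis
  obtain s where s: "\<Delta> x = tensor2 scale s" using comult_tensor by auto
  define t' where "t' = formal_eval free_scale (\<lambda>a b. Poly_Mapping.single (P a, P b) 1) t"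
  have "Poly_Mapping.keys t' \<subseteq> (\<Union>p\<in>Poly_Mapping.keys t. E \<times> E)"
    unfolding t'_def formal_eval_def
  proof (rule order.trans[OF keys_sum UN_mono])
    fix p
    show "Poly_Mapping.keys (free_scale (Poly_Mapping.lookup t p) (Poly_Mapping.single (P (fst p), P (snd p)) 1)) \<subseteq> E \<times> E"
      using P(2) by (auto simp: in_keys_iff lookup_free_scale lookup_single when_def split: if_splits)
  qed simp
  then have keys: "Poly_Mapping.keys t' \<subseteq> E \<times> E" by blast
  have "t - t' \<in> tensor_relations scale slots2"
  proof (rule tensor_relations_if_contractions_vanish)
    fix g assume g: "g \<in> dual"
    interpret ev: Vector_Spaces.linear free_scale scale "formal_eval scale (\<lambda>a b. scale (g b) a)"
      by (rule formal_eval_linear) (rule vector_space_axioms)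
    have gP: "g \<circ> P \<in> dual" using g by (auto simp: dual_iff P.add P.scale)
    have "formal_eval scale (\<lambda>a b. scale (g b) a) t' = P (left_act (g \<circ> P) x)"
      unfolding t'_def left_act_rep[OF gP t] linear_formal_eval[OF formal_eval_linear[OF vector_space_axioms]]
        linear_formal_eval[OF P(1)]
      by (simp add: formal_eval_single[OF vector_space_axioms] P.scale)
    also have "\<dots> = left_act (g \<circ> P) x"
      using assms x gP by (intro P(3)) (simp add: bisubmodule_def)
    also have "\<dots> = left_act g x"
    proof (rule dual_eqI)
      fix f assume f: "f \<in> dual"
      have "P (right_act x f) = right_act x f" using assms x f by (intro P(3)) (simp add: bisubmodule_def)
      then show "f (left_act (g \<circ> P) x) = f (left_act g x)"
        using f g gP by (simp add: dual_left_act dual_right_act[symmetric])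
    qed
    finally show "formal_eval scale (\<lambda>a b. scale (g b) a) (t - t') = 0"
      by (simp add: ev.diff left_act_rep[OF g t])
  qed
  then have "\<Delta> x = tensor2 scale t'"
    using t s by (metis tensor_class_eq_iff tensor_class_def mem_Collect_eq)
  then show "\<exists>t. Poly_Mapping.keys t \<subseteq> E \<times> E \<and> \<Delta> x = tensor2 scale t" using keys by blast
qed

lemma simple_subcoalgebraD:
  assumes "simple_subcoalgebra D"
  shows "bisubmodule D" "bisubmodule E \<Longrightarrow> E \<subseteq> D \<Longrightarrow> E = {0} \<or> E = D"
  using assms subcoalgebra_imp_bisubmodule bisubmodule_imp_subcoalgebra
  by (auto simp: simple_subcoalgebra_def)

text \<open>
  By simplicity \<open>D\<close> is spanned by the elements \<open>f \<cdot> x \<cdot> g\<close> for one \<open>x \<noteq> 0\<close>. These are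
  combinations of the finitely many middle components of a representative of the twofold
  comultiplication of \<open>x\<close>.
\<close>

lemma simple_subcoalgebra_finite_dimensional:
  assumes D: "simple_subcoalgebra D"
  shows "\<exists>S. finite S \<and> D \<subseteq> span S"
proof -
  have "subspace D" "D \<noteq> {0}" using D by (auto simp: simple_subcoalgebra_def subcoalgebra_def)
  then obtain x where x: "x \<in> D" "x \<noteq> 0" using subspace_0 by blast
  obtain rep where rep: "\<And>y. rep y \<in> \<Delta> y" using comult_nonempty by metis
  define S where "S = (\<Union>p\<in>Poly_Mapping.keys (rep x). snd ` Poly_Mapping.keys (rep (fst p)))"
  define E where "E = span {right_act (left_act f x) g | f g. f \<in> dual \<and> g \<in> dual}"
  have "bisubmodule E" unfolding E_def
  proof (rule bisubmodule_span)
    fix h y assume h: "h \<in> dual" and "y \<in> {right_act (left_act f x) g | f g. f \<in> dual \<and> g \<in> dual}"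
    then obtain f g where y: "y = right_act (left_act f x) g" "f \<in> dual" "g \<in> dual" by auto
    have "left_act h y = right_act (left_act (convolution h f) x) g"
      "right_act y h = right_act (left_act f x) (convolution g h)"
      using h y by (simp_all add: left_act_right_act left_act_left_act right_act_right_act)
    then show "left_act h y \<in> span {right_act (left_act f x) g | f g. f \<in> dual \<and> g \<in> dual} \<and>
        right_act y h \<in> span {right_act (left_act f x) g | f g. f \<in> dual \<and> g \<in> dual}"
      using h y convolution_dual by (blast intro: span_base)
  qed
  moreover have "E \<subseteq> D"
    unfolding E_def using simple_subcoalgebraD(1)[OF D] x(1)
    by (intro span_minimal) (auto simp: bisubmodule_def)
  moreover have "x \<in> E" unfolding E_def
    using counit_dual by (intro span_base CollectI exI[of _ \<epsilon>]) simp
  ultimately have "E = D" using simple_subcoalgebraD(2)[OF D] x by blast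
  moreover have "E \<subseteq> span S" unfolding E_def
  proof (rule span_minimal)
    show "subspace (span S)" by (rule subspace_span)
    have "right_act (left_act f x) g \<in> span S" if f: "f \<in> dual" and g: "g \<in> dual" for f g
    proof -
      interpret r: Vector_Spaces.linear scale scale "\<lambda>x. right_act x g" by (rule right_act_linear[OF g])
      have "right_act (fst p) g \<in> span S" if "p \<in> Poly_Mapping.keys (rep x)" for p
        using that unfolding right_act_rep[OF g rep] formal_eval_def
        by (intro span_sum span_scale span_base) (auto simp: S_def)
      then show ?thesis
        unfolding left_act_rep[OF f rep] formal_eval_def r.sum r.scale
        by (intro span_sum span_scale)
    qed
    then show "{right_act (left_act f x) g | f g. f \<in> dual \<and> g \<in> dual} \<subseteq> span S" by auto
  qed
  moreover have "finite S" by (simp add: S_def)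
  ultimately show ?thesis by blast
qed

end

section \<open>A simple summand and its dual algebra\<close>

locale simple_summand = coalgebra scale \<Delta> \<epsilon>
  for scale :: "'k::field \<Rightarrow> 'c::ab_group_add \<Rightarrow> 'c" and \<Delta> \<epsilon> +
  fixes D W :: "'c set"
  assumes simple_D: "simple_subcoalgebra D"
    and bisubmodule_W: "bisubmodule W"
    and disjoint: "D \<inter> W = {0}"
    and spanning: "\<exists>d\<in>D. x - d \<in> W"
begin

lemma bisubmodule_D: "bisubmodule D"
  using simple_subcoalgebraD(1)[OF simple_D] .

lemma subspace_D: "subspace D" and subspace_W: "subspace W"
  using bisubmodule_D bisubmodule_W by (auto simp: bisubmodule_def)

lemma act_closed:
  "f \<in> dual \<Longrightarrow> x \<in> D \<Longrightarrow> left_act f x \<in> D" "f \<in> dual \<Longrightarrow> x \<in> D \<Longrightarrow> right_act x f \<in> D"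
  "f \<in> dual \<Longrightarrow> x \<in> W \<Longrightarrow> left_act f x \<in> W" "f \<in> dual \<Longrightarrow> x \<in> W \<Longrightarrow> right_act x f \<in> W"
  using bisubmodule_D bisubmodule_W by (auto simp: bisubmodule_def)

definition proj :: "'c \<Rightarrow> 'c" where
  "proj = (SOME P. Vector_Spaces.linear scale scale P \<and> (\<forall>x. P x \<in> D) \<and> (\<forall>u\<in>D. P u = u) \<and> (\<forall>w\<in>W. P w = 0))"

lemma proj:
  "Vector_Spaces.linear scale scale proj" "proj x \<in> D" "x \<in> D \<Longrightarrow> proj x = x" "x \<in> W \<Longrightarrow> proj x = 0"
  using someI_ex[OF projection_exists[OF subspace_D subspace_W disjoint spanning]]
  unfolding proj_def[symmetric] by blast+

sublocale proj: Vector_Spaces.linear scale scale proj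
  by (rule proj)

definition restrict :: "('c \<Rightarrow> 'k) \<Rightarrow> 'c \<Rightarrow> 'k" where
  "restrict f = (\<lambda>x. f (proj x))"

text \<open>
  The dual of \<open>D\<close>, realised as functionals on \<open>C\<close>: extension by zero on the complement \<open>W\<close>
  is compatible with convolution because \<open>W\<close> is a sub-bimodule.
\<close>

definition dual_D :: "('c \<Rightarrow> 'k) set" where
  "dual_D = {f \<in> dual. \<forall>x\<in>W. f x = 0}"

lemma restrict_dual: "f \<in> dual \<Longrightarrow> restrict f \<in> dual"
  by (auto simp: restrict_def dual_iff proj.add proj.scale)

lemma restrict_dual_D: "f \<in> dual \<Longrightarrow> restrict f \<in> dual_D"
  using restrict_dual by (auto simp: dual_D_def restrict_def proj dual_zero)

lemma restrict_on_D: "x \<in> D \<Longrightarrow> restrict f x = f x"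
  by (simp add: restrict_def proj)

lemma dual_D_dual: "f \<in> dual_D \<Longrightarrow> f \<in> dual"
  by (simp add: dual_D_def)

lemma dual_D_proj: "f \<in> dual_D \<Longrightarrow> f (proj x) = f x"
proof -
  assume f: "f \<in> dual_D"
  obtain d where d: "d \<in> D" "x - d \<in> W" using spanning by auto
  have "proj x = d" using proj.diff[of x d] proj(3)[OF d(1)] proj(4)[OF d(2)] by simp
  then show "f (proj x) = f x" using f d dual_diff[of f x d] by (simp add: dual_D_def)
qed

lemma dual_D_eqI: "f \<in> dual_D \<Longrightarrow> g \<in> dual_D \<Longrightarrow> (\<And>x. x \<in> D \<Longrightarrow> f x = g x) \<Longrightarrow> f = g"
  by (rule ext) (metis dual_D_proj proj(2))

lemma convolution_dual_D: "f \<in> dual_D \<Longrightarrow> g \<in> dual \<Longrightarrow> convolution f g \<in> dual_D"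
  by (auto simp: dual_D_def convolution_dual dual_left_act[symmetric] act_closed)

abbreviation pscale :: "'k \<Rightarrow> ('c \<Rightarrow> 'k) \<Rightarrow> 'c \<Rightarrow> 'k" where
  "pscale c f \<equiv> \<lambda>x. c * f x"

lemma vector_space_pscale: "vector_space pscale"
  by unfold_locales (simp_all add: fun_eq_iff algebra_simps)

lemma subspace_dual_D: "module.subspace pscale dual_D"
proof -
  interpret F: vector_space pscale by (rule vector_space_pscale)
  show ?thesis by (rule F.subspaceI) (auto simp: dual_D_def dual_closed)
qed

definition basis :: "'c set" where
  "basis = (SOME B. B \<subseteq> D \<and> independent B \<and> D \<subseteq> span B)"

lemma basis: "basis \<subseteq> D" "independent basis" "D \<subseteq> span basis" "finite basis"
proof -
  obtain B where "B \<subseteq> D" "independent B" "D \<subseteq> span B" by (rule basis_exists)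
  then have "\<exists>B. B \<subseteq> D \<and> independent B \<and> D \<subseteq> span B" by blast
  from someI_ex[OF this] show b: "basis \<subseteq> D" "independent basis" "D \<subseteq> span basis"
    by (auto simp: basis_def)
  obtain S where "finite S" "D \<subseteq> span S"
    using simple_subcoalgebra_finite_dimensional[OF simple_D] by auto
  then show "finite basis" using independent_span_bound b by blast
qed

definition coord :: "'c \<Rightarrow> 'c \<Rightarrow> 'k" where
  "coord b x = representation basis (proj x) b"

lemma dual_D_expand: "f \<in> dual_D \<Longrightarrow> f = (\<Sum>b\<in>basis. pscale (f b) (coord b))"
proof
  fix x
  assume f: "f \<in> dual_D"
  interpret f: Vector_Spaces.linear scale "(*)" f using f by (simp add: dual_D_def dual_def)
  have "proj x = (\<Sum>b\<in>basis. scale (coord b x) b)"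
    unfolding coord_def using basis proj(2)[of x] by (intro sum_representation_eq[symmetric]) auto
  then have "f (proj x) = (\<Sum>b\<in>basis. coord b x * f b)" by (simp add: f.sum f.scale)
  moreover have "(\<Sum>b\<in>S. pscale (f b) (coord b)) x = (\<Sum>b\<in>S. f b * coord b x)" for S
    by (induction S rule: infinite_finite_induct) auto
  ultimately show "f x = (\<Sum>b\<in>basis. pscale (f b) (coord b)) x"
    using dual_D_proj[OF f] by (simp add: mult.commute)
qed

lemma functional_is_evaluation:
  assumes "Vector_Spaces.linear pscale (*) \<Lambda>"
  shows "\<exists>z\<in>D. \<forall>f\<in>dual_D. f z = \<Lambda> f"
proof -
  interpret L: Vector_Spaces.linear pscale "(*)" \<Lambda> by fact
  define z where "z = (\<Sum>b\<in>basis. scale (\<Lambda> (coord b)) b)"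
  have "f z = \<Lambda> f" if f: "f \<in> dual_D" for f
  proof -
    interpret f: Vector_Spaces.linear scale "(*)" f using f by (simp add: dual_D_def dual_def)
    have "\<Lambda> f = (\<Sum>b\<in>basis. f b * \<Lambda> (coord b))"
      by (subst dual_D_expand[OF f]) (simp add: L.sum L.scale)
    then show ?thesis by (simp add: z_def f.sum f.scale mult.commute)
  qed
  moreover have "z \<in> D" unfolding z_def using basis(1)
    by (intro subspace_sum[OF subspace_D] subspace_scale[OF subspace_D]) auto
  ultimately show ?thesis by blast
qed

text \<open>
  The common zeros \<open>J\<close> of an ideal \<open>I\<close> in \<open>D\<close> form a sub-bimodule, so they are \<open>D\<close> or \<open>0\<close>.
  If \<open>J = 0\<close> and \<open>g\<close> were not in \<open>I\<close>, a functional on the dual that separates \<open>g\<close> from \<open>I\<close>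
  would be evaluation at a nonzero point of \<open>J\<close>.
\<close>

lemma ideal_dual_D_trivial:
  assumes I: "module.subspace pscale I" "I \<subseteq> dual_D"
    and ideal: "\<And>f i. f \<in> dual_D \<Longrightarrow> i \<in> I \<Longrightarrow> convolution f i \<in> I \<and> convolution i f \<in> I"
  shows "I = {0} \<or> I = dual_D"
proof -
  interpret F: vector_space pscale by (rule vector_space_pscale)
  define J where "J = {x \<in> D. \<forall>f\<in>I. f x = 0}"
  have Idual: "f \<in> dual" if "f \<in> I" for f using that I(2) dual_D_dual by auto
  have "bisubmodule J"
    unfolding bisubmodule_def
  proof (intro conjI ballI)
    show "subspace J"
      unfolding J_def using Idual subspace_D
      by (intro subspaceI) (auto simp: dual_zero dual_add dual_scale intro: subspace_0 subspace_add subspace_scale)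
    fix g x assume g: "g \<in> dual" and x: "x \<in> J"
    note [simp] = restrict_dual[OF g]
    have xD: "x \<in> D" using x by (simp add: J_def)
    have "f (left_act g x) = 0 \<and> f (right_act x g) = 0" if f: "f \<in> I" for f
    proof -
      have "f (left_act g x) = restrict g (right_act x f)"
        using Idual[OF f] g xD
        by (simp add: dual_left_act dual_right_act[symmetric] restrict_on_D act_closed)
      also have "\<dots> = convolution f (restrict g) x" using Idual[OF f] by (simp add: dual_right_act)
      also have "\<dots> = 0" using ideal[OF restrict_dual_D[OF g] f] x by (auto simp: J_def)
      finally have 1: "f (left_act g x) = 0" .
      have "f (right_act x g) = restrict g (left_act f x)"
        using Idual[OF f] g xD
        by (simp add: dual_right_act dual_left_act[symmetric] restrict_on_D act_closed)
      also have "\<dots> = convolution (restrict g) f x" using Idual[OF f] by (simp add: dual_left_act)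
      also have "\<dots> = 0" using ideal[OF restrict_dual_D[OF g] f] x by (auto simp: J_def)
      finally show ?thesis using 1 by simp
    qed
    then show "left_act g x \<in> J" "right_act x g \<in> J"
      using g xD by (simp_all add: J_def act_closed)
  qed
  moreover have "J \<subseteq> D" by (auto simp: J_def)
  ultimately consider "J = D" | "J = {0}" using simple_subcoalgebraD(2)[OF simple_D] by blast
  then show ?thesis
  proof cases
    case 1
    have "f = 0" if "f \<in> I" for f
      using that I(2) 1 F.subspace_0[OF subspace_dual_D]
      by (intro dual_D_eqI) (auto simp: J_def)
    then show ?thesis using F.subspace_0[OF I(1)] by blast
  next
    case 2
    have "g \<in> I" if g: "g \<in> dual_D" for g
    proof (rule ccontr)
      assume "g \<notin> I"
      from separating_functional[OF vector_space_pscale I(1) this]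
      obtain \<Lambda> where \<Lambda>: "Vector_Spaces.linear pscale (*) \<Lambda>" "\<Lambda> g = 1" "\<forall>f\<in>I. \<Lambda> f = 0" by blast
      from functional_is_evaluation[OF \<Lambda>(1)]
      obtain z where z: "z \<in> D" "\<And>f. f \<in> dual_D \<Longrightarrow> f z = \<Lambda> f" by blast
      have "f z = 0" if "f \<in> I" for f using z(2)[of f] \<Lambda>(3) I(2) that by auto
      then have "z \<in> J" using z(1) by (simp add: J_def)
      then have "g z = 0" using 2 dual_zero dual_D_dual g by auto
      then show False using z(2)[OF g] \<Lambda>(2) by simp
    qed
    then show ?thesis using I(2) by blast
  qed
qed

lemma dual_D_simple_algebra: "fd_simple_algebra pscale dual_D convolution (restrict \<epsilon>)"
proof -
  interpret F: vector_space pscale by (rule vector_space_pscale)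
  have unit: "convolution (restrict \<epsilon>) f = f" "convolution f (restrict \<epsilon>) = f" if f: "f \<in> dual_D" for f
  proof -
    note f' = dual_D_dual[OF f] and e = restrict_dual[OF counit_dual] counit_dual
    have unit_eq: "\<epsilon> (left_act f x) = f x" "\<epsilon> (right_act x f) = f x" for x
      using f' e by (simp_all add: dual_left_act dual_right_act dual_right_act[symmetric, where f=\<epsilon>]
          dual_left_act[symmetric, where g=\<epsilon>])
    show "convolution (restrict \<epsilon>) f = f"
      by (rule dual_D_eqI[OF convolution_dual_D[OF restrict_dual_D[OF e(2)] f'] f])
        (simp add: dual_left_act[OF e(1) f', symmetric] restrict_on_D act_closed f' unit_eq)
    show "convolution f (restrict \<epsilon>) = f"
      by (rule dual_D_eqI[OF convolution_dual_D[OF f e(1)] f])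
        (simp add: dual_right_act[OF f' e(1), symmetric] restrict_on_D act_closed f' unit_eq)
  qed
  show ?thesis
  proof unfold_locales
    show "F.subspace dual_D" by (rule subspace_dual_D)
    show "dual_D \<noteq> {0}"
    proof
      assume *: "dual_D = {0}"
      have "subspace D" "D \<noteq> {0}" using simple_D subspace_D by (auto simp: simple_subcoalgebra_def)
      then obtain x where x: "x \<in> D" "x \<noteq> 0" using subspace_0 by blast
      have "f x = f 0" if "f \<in> dual" for f
        using restrict_dual_D[OF that] restrict_on_D[OF x(1), of f] * dual_zero[OF that] by simp
      then show False using dual_eqI x(2) by blast
    qed
    show "\<exists>B. finite B \<and> dual_D \<subseteq> F.span B"
    proof (intro exI conjI subsetI)
      show "finite (coord ` basis)" using basis by simp
      fix f assume "f \<in> dual_D"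
      have "(\<Sum>b\<in>basis. pscale (f b) (coord b)) \<in> F.span (coord ` basis)"
      proof (rule F.span_sum)
        fix b assume "b \<in> basis"
        then show "pscale (f b) (coord b) \<in> F.span (coord ` basis)"
          by (intro F.span_scale[where x="coord b"] F.span_base imageI)
      qed
      then show "f \<in> F.span (coord ` basis)"
        using dual_D_expand[OF \<open>f \<in> dual_D\<close>] by simp
    qed
    show "I = {0} \<or> I = dual_D" if "F.subspace I" "I \<subseteq> dual_D"
      "\<And>f i. f \<in> dual_D \<Longrightarrow> i \<in> I \<Longrightarrow> convolution f i \<in> I \<and> convolution i f \<in> I" for I
      using that by (rule ideal_dual_D_trivial)
    fix f g h assume fgh: "f \<in> dual_D" "g \<in> dual_D" "h \<in> dual_D"
    note d = fgh[THEN dual_D_dual]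
    show "convolution (convolution f g) h = convolution f (convolution g h)"
      using d by (rule convolution_assoc)
    show "convolution (f + g) h = convolution f h + convolution g h"
      using d by (auto simp: fun_eq_iff dual_left_act[symmetric] dual_closed)
    show "convolution f (g + h) = convolution f g + convolution f h"
      using d by (auto simp: fun_eq_iff dual_right_act[symmetric] dual_closed)
  next
    fix f g c assume fg: "f \<in> dual_D" "g \<in> dual_D"
    note d = fg[THEN dual_D_dual]
    show "convolution f g \<in> dual_D" using fg d by (intro convolution_dual_D)
    show "convolution (pscale c f) g = pscale c (convolution f g)"
      using d by (auto simp: fun_eq_iff dual_left_act[symmetric] dual_closed)
    show "convolution f (pscale c g) = pscale c (convolution f g)"
      using d by (auto simp: fun_eq_iff dual_right_act[symmetric] dual_closed)
  qed (use unit restrict_dual_D[OF counit_dual] in auto)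
qed

lemma left_act_cong:
  assumes "f \<in> dual" "g \<in> dual" "x \<in> D" "\<And>y. y \<in> D \<Longrightarrow> f y = g y"
  shows "left_act f x = left_act g x"
proof (rule dual_eqI)
  fix h assume h: "h \<in> dual"
  then show "h (left_act f x) = h (left_act g x)"
    using assms act_closed(2)[OF h assms(3)] by (simp add: dual_left_act dual_right_act[symmetric])
qed

text \<open>
  A trace of the dual algebra is the evaluation at a point \<open>z\<close> of \<open>D\<close>, and \<open>h (f \<cdot> z)\<close> and
  \<open>h (z \<cdot> f)\<close> are the values of the trace at the two products of \<open>h\<close> and \<open>f\<close> restricted to
  \<open>D\<close>.
\<close>

theorem central_element_exists: "\<exists>z\<in>D. z \<noteq> 0 \<and> (\<forall>f\<in>dual. left_act f z = right_act z f)"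
proof -
  interpret A: fd_simple_algebra pscale dual_D convolution "restrict \<epsilon>" by (rule dual_D_simple_algebra)
  from A.trace_exists obtain \<tau> where \<tau>: "Vector_Spaces.linear pscale (*) \<tau>"
    "\<And>f g. f \<in> dual_D \<Longrightarrow> g \<in> dual_D \<Longrightarrow> \<tau> (convolution f g) = \<tau> (convolution g f)"
    "\<exists>f\<in>dual_D. \<tau> f \<noteq> 0" by blast
  from functional_is_evaluation[OF \<tau>(1)]
  obtain z where z: "z \<in> D" "\<And>f. f \<in> dual_D \<Longrightarrow> f z = \<tau> f" by blast
  have "z \<noteq> 0" using \<tau>(3) z(2) dual_zero dual_D_dual by force
  moreover have "left_act f z = right_act z f" if f: "f \<in> dual" for f
  proof (rule dual_eqI)
    fix h assume h: "h \<in> dual"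
    note r = restrict_dual[OF f] restrict_dual[OF h] restrict_dual_D[OF f] restrict_dual_D[OF h]
    have "h (left_act f z) = restrict h (left_act f z)"
      using z(1) f by (simp add: restrict_on_D act_closed)
    also have "\<dots> = f (right_act z (restrict h))"
      using f r by (simp add: dual_left_act dual_right_act)
    also have "\<dots> = restrict f (right_act z (restrict h))"
      using z(1) r by (simp add: restrict_on_D act_closed)
    also have "\<dots> = convolution (restrict h) (restrict f) z" using r by (simp add: dual_right_act)
    also have "\<dots> = convolution (restrict f) (restrict h) z"
      using r \<tau>(2) z(2) by (simp add: convolution_dual_D)
    also have "\<dots> = restrict f (left_act (restrict h) z)" using r by (simp add: dual_left_act)
    also have "\<dots> = f (left_act (restrict h) z)"
      using z(1) r by (simp add: restrict_on_D act_closed)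
    also have "\<dots> = restrict h (right_act z f)"
      using f r by (simp add: dual_left_act dual_right_act)
    also have "\<dots> = h (right_act z f)"
      using z(1) f by (simp add: restrict_on_D act_closed)
    finally show "h (left_act f z) = h (right_act z f)" .
  qed
  ultimately show ?thesis using z(1) by blast
qed

text \<open>
  Since \<open>z\<close> is central, \<open>{f \<cdot> z}\<close> is a sub-bimodule and contains \<open>z = \<epsilon> \<cdot> z\<close>, so it is \<open>D\<close>.
  If \<open>f \<cdot> z = 0\<close>, then also \<open>f \<cdot> (z \<cdot> g) = 0\<close> for all \<open>g\<close>; so \<open>f\<close> annihilates \<open>D\<close>, and
  \<open>f x = \<epsilon> (f \<cdot> x) = 0\<close> on \<open>D\<close>.
\<close>

lemma central_element_generates:
  assumes z: "z \<in> D" "z \<noteq> 0" "\<And>f. f \<in> dual \<Longrightarrow> left_act f z = right_act z f"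
  shows "x \<in> D \<Longrightarrow> \<exists>f\<in>dual_D. left_act f z = x"
    and "f \<in> dual \<Longrightarrow> left_act f z = 0 \<Longrightarrow> x \<in> D \<Longrightarrow> f x = 0"
proof -
  let ?S = "{left_act f z | f. f \<in> dual}"
  have "subspace ?S"
  proof (rule subspaceI)
    show "0 \<in> ?S" using left_act_zero[of z, symmetric] dual_closed(4) by blast
    show "x + y \<in> ?S" if "x \<in> ?S" "y \<in> ?S" for x y
      using that by (auto simp: left_act_add[symmetric] intro!: dual_closed)
    show "scale c x \<in> ?S" if "x \<in> ?S" for c x
      using that by (auto simp: left_act_scale[symmetric] intro!: dual_closed)
  qed
  moreover have "left_act f (left_act g z) \<in> ?S \<and> right_act (left_act g z) f \<in> ?S"
    if "f \<in> dual" "g \<in> dual" for f g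
  proof -
    have "right_act (left_act g z) f = left_act g (left_act f z)"
      using that z(3) by (simp add: left_act_right_act)
    then show ?thesis using that convolution_dual by (auto simp: left_act_left_act)
  qed
  ultimately have "bisubmodule ?S" by (auto simp: bisubmodule_def)
  moreover have "?S \<subseteq> D" using z(1) act_closed by auto
  moreover have "z \<in> ?S" using counit_dual left_act_counit[of z, symmetric] by blast
  ultimately have S: "?S = D" using simple_subcoalgebraD(2)[OF simple_D] z(2) by blast
  show "\<exists>f\<in>dual_D. left_act f z = x" if "x \<in> D"
  proof -
    have "x \<in> ?S" unfolding S by (rule that)
    then obtain f where f: "f \<in> dual" "left_act f z = x" by auto
    then have "left_act (restrict f) z = x"
      using left_act_cong[of f "restrict f" z] z(1) by (simp add: restrict_dual restrict_on_D)
    then show ?thesis using restrict_dual_D[OF f(1)] by blast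
  qed
  show "f x = 0" if f: "f \<in> dual" "left_act f z = 0" and x: "x \<in> D"
  proof -
    have "x \<in> ?S" unfolding S by (rule x)
    then obtain g where g: "g \<in> dual" "left_act g z = x" by auto
    interpret r: Vector_Spaces.linear scale scale "\<lambda>x. right_act x g" by (rule right_act_linear[OF g(1)])
    have "f x = f (right_act z g)" using g z(3) by simp
    also have "\<dots> = \<epsilon> (left_act f (right_act z g))"
      using f g counit_dual by (simp add: dual_left_act dual_right_act[symmetric, where f=\<epsilon>])
    also have "left_act f (right_act z g) = 0" using f g by (simp add: left_act_right_act r.zero)
    finally show ?thesis using counit_dual by (simp add: dual_zero)
  qed
qed

end

section \<open>Assembling the summands\<close>

context coalgebra
begin

text \<open>
  Only finitely many summands occur in \<open>x\<close>; as the \<open>D\<close>-component of \<open>x\<close> is zero for each of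
  them, they can be removed one at a time.
\<close>

lemma eq_0_if_in_all_complements:
  assumes indep: "\<forall>D\<in>\<D>. D \<inter> span (\<Union>(\<D> - {D})) = {0}" and sub: "\<forall>D\<in>\<D>. subspace D"
    and x: "x \<in> span (\<Union>\<D>)" "\<And>D. D \<in> \<D> \<Longrightarrow> x \<in> span (\<Union>(\<D> - {D}))"
  shows "x = 0"
proof -
  obtain S where S: "finite S" "S \<subseteq> \<Union>\<D>" "x \<in> span S"
    using x(1) unfolding span_explicit by (force intro: span_sum span_scale span_base)
  from finite_subset_Union[OF S(1,2)]
  obtain \<F> where \<F>: "finite \<F>" "\<F> \<subseteq> \<D>" "S \<subseteq> \<Union>\<F>" by blast
  have "x \<in> span (\<Union>\<F>)" using S(3) span_mono[OF \<F>(3)] by blast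
  with \<F>(1,2) show ?thesis
  proof (induction \<F>)
    case empty
    then show ?case by simp
  next
    case (insert D \<F>)
    then have "x \<in> span (D \<union> \<Union>\<F>)" by simp
    then obtain d y where dy: "x = d + y" "d \<in> span D" "y \<in> span (\<Union>\<F>)"
      unfolding span_Un by blast
    have "\<Union>\<F> \<subseteq> \<Union>(\<D> - {D})" using insert.prems insert.hyps by blast
    then have "y \<in> span (\<Union>(\<D> - {D}))" using dy(3) span_mono by blast
    then have "d \<in> span (\<Union>(\<D> - {D}))" using span_diff[OF x(2)[of D]] insert.prems dy(1) by force
    moreover have "span D = D" using sub insert.prems by (simp add: span_eq_iff)
    ultimately have "d = 0" using indep insert.prems dy(2) by blast
    then show ?case using insert dy by simp
  qed
qed

end

theorem corollary4p6:
  fixes scale :: "'k::field \<Rightarrow> 'c::ab_group_add \<Rightarrow> 'c"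
    and \<Delta> :: "'c \<Rightarrow> ('c \<times> 'c \<Rightarrow>\<^sub>0 'k) set"
    and \<epsilon> :: "'c \<Rightarrow> 'k"
  assumes "coalgebra scale \<Delta> \<epsilon>"
    and "coalgebra.cosemisimple scale \<Delta>"
  shows "coalgebra.symmetric scale \<Delta>"
proof -
  interpret coalgebra scale \<Delta> \<epsilon> by fact
  obtain \<D> where \<D>: "(\<forall>D\<in>\<D>. simple_subcoalgebra D) \<and> span (\<Union>\<D>) = UNIV \<and>
      (\<forall>D\<in>\<D>. D \<inter> span (\<Union>(\<D> - {D})) = {0})"
    using assms(2) unfolding cosemisimple_def by (rule exE)
  note simple = \<D>[THEN conjunct1, rule_format]
    and total = \<D>[THEN conjunct2, THEN conjunct1]
    and indep = \<D>[THEN conjunct2, THEN conjunct2]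
  define C where "C D = span (\<Union>(\<D> - {D}))" for D
  have bi: "bisubmodule D" if "D \<in> \<D>" for D using simple_subcoalgebraD(1) simple that by blast
  have subD: "subspace D" if "D \<in> \<D>" for D using bi[OF that] by (simp add: bisubmodule_def)
  have biC: "bisubmodule (C D)" for D
    unfolding C_def by (rule bisubmodule_span) (use bi in \<open>blast intro: span_base dest: bisubmodule_def[THEN iffD1]\<close>)
  then have subC: "subspace (C D)" for D by (simp add: bisubmodule_def)
  have summand: "simple_summand scale \<Delta> \<epsilon> D (C D)" if D: "D \<in> \<D>" for D
  proof unfold_locales
    show "simple_subcoalgebra D" "bisubmodule (C D)" "D \<inter> C D = {0}"
      using simple biC indep D by (auto simp: C_def)
    fix x
    have "\<Union>\<D> = D \<union> \<Union>(\<D> - {D})" using D by blast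
    then have "x \<in> span (D \<union> \<Union>(\<D> - {D}))" using total by simp
    then obtain d y where "x = d + y" "d \<in> span D" "y \<in> C D"
      unfolding span_Un C_def by blast
    moreover have "span D = D" using subD[OF D] by (simp add: span_eq_iff)
    ultimately show "\<exists>d\<in>D. x - d \<in> C D" by (intro bexI[of _ d]) auto
  qed
  have "\<exists>z. \<forall>D\<in>\<D>. z D \<in> D \<and> z D \<noteq> 0 \<and> (\<forall>f\<in>dual. left_act f (z D) = right_act (z D) f)"
    using simple_summand.central_element_exists[OF summand] by (intro bchoice) blast
  then obtain z where z: "\<And>D. D \<in> \<D> \<Longrightarrow> z D \<in> D" "\<And>D. D \<in> \<D> \<Longrightarrow> z D \<noteq> 0"
    "\<And>D f. D \<in> \<D> \<Longrightarrow> f \<in> dual \<Longrightarrow> left_act f (z D) = right_act (z D) f" by blast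
  \<comment> \<open>\<open>R x f\<close> says that \<open>f \<cdot> z D\<close> is the \<open>D\<close>-component of \<open>x\<close> for every \<open>D\<close>. As a congruence modulo the complement
    it is visibly compatible with sums, scalars and both actions.\<close>
  define R where "R x f \<longleftrightarrow> f \<in> dual \<and> (\<forall>D\<in>\<D>. x - left_act f (z D) \<in> C D)" for x f
  have R_dual: "f \<in> dual" if "R x f" for x f using that by (simp add: R_def)
  have R_add: "R (x + y) (f + g)" if "R x f" "R y g" for x y f g
    unfolding R_def
  proof (intro conjI ballI)
    show "f + g \<in> dual" using that by (auto simp: R_def intro: dual_closed)
    fix D assume "D \<in> \<D>"
    then have "(x - left_act f (z D)) + (y - left_act g (z D)) \<in> C D"
      using that by (intro subspace_add[OF subC]) (auto simp: R_def)
    then show "(x + y) - left_act (f + g) (z D) \<in> C D"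
      using that by (simp add: R_def left_act_add algebra_simps)
  qed
  have R_scale: "R (scale c x) (\<lambda>y. c * f y)" if "R x f" for c x f
    unfolding R_def
  proof (intro conjI ballI)
    show "(\<lambda>y. c * f y) \<in> dual" using that by (auto simp: R_def intro: dual_closed)
    fix D assume "D \<in> \<D>"
    then have "scale c (x - left_act f (z D)) \<in> C D"
      using that by (intro subspace_scale[OF subC]) (auto simp: R_def)
    then show "scale c x - left_act (\<lambda>y. c * f y) (z D) \<in> C D"
      using that by (simp add: R_def left_act_scale scale_right_diff_distrib)
  qed
  have R_left: "R (left_act g x) (convolution g f)" if "R x f" "g \<in> dual" for g x f
    unfolding R_def
  proof (intro conjI ballI)
    show "convolution g f \<in> dual" using that by (auto simp: R_def intro: convolution_dual)
    interpret l: Vector_Spaces.linear scale scale "left_act g" by (rule left_act_linear[OF that(2)])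
    fix D assume "D \<in> \<D>"
    then have "left_act g (x - left_act f (z D)) \<in> C D"
      using that biC by (auto simp: R_def bisubmodule_def)
    then show "left_act g x - left_act (convolution g f) (z D) \<in> C D"
      using that by (simp add: R_def l.diff left_act_left_act)
  qed
  have R_right: "R (right_act x g) (convolution f g)" if "R x f" "g \<in> dual" for g x f
    unfolding R_def
  proof (intro conjI ballI)
    show "convolution f g \<in> dual" using that by (auto simp: R_def intro: convolution_dual)
    interpret r: Vector_Spaces.linear scale scale "\<lambda>x. right_act x g" by (rule right_act_linear[OF that(2)])
    fix D assume D: "D \<in> \<D>"
    \<comment> \<open>The one place where \<open>z D\<close> has to be central.\<close>
    have "right_act (left_act f (z D)) g = left_act (convolution f g) (z D)"
      using that z(3)[OF D] by (simp add: R_def left_act_right_act[symmetric] left_act_left_act flip: z(3)[OF D])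
    moreover have "right_act (x - left_act f (z D)) g \<in> C D"
      using that biC D by (auto simp: R_def bisubmodule_def)
    ultimately show "right_act x g - left_act (convolution f g) (z D) \<in> C D"
      by (simp add: r.diff)
  qed
  have R_unique: "f = g" if "R x f" "R x g" for x f g
  proof -
    have fg: "f - g \<in> dual" using that by (auto simp: R_def intro: dual_closed)
    have "(f - g) y = 0" if D: "D \<in> \<D>" "y \<in> D" for D y
    proof -
      interpret S: simple_summand scale \<Delta> \<epsilon> D "C D" by (rule summand[OF D(1)])
      have "x - left_act g (z D) \<in> C D" "x - left_act f (z D) \<in> C D"
        using \<open>R x f\<close> \<open>R x g\<close> D(1) by (auto simp: R_def)
      from subspace_diff[OF subC this] have "left_act (f - g) (z D) \<in> C D"
        using \<open>R x f\<close> \<open>R x g\<close> by (simp add: R_dual left_act_diff)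
      moreover have "left_act (f - g) (z D) \<in> D" using S.act_closed(1)[OF fg z(1)[OF D(1)]] .
      ultimately have "left_act (f - g) (z D) = 0" using S.disjoint by blast
      then show ?thesis using S.central_element_generates(2)[OF z(1,2,3)[OF D(1)] fg _ D(2)] by blast
    qed
    then have "\<Union>\<D> \<subseteq> {y. (f - g) y = 0}" by blast
    moreover have "subspace {y. (f - g) y = 0}"
      using fg by (intro subspaceI) (simp_all only: mem_Collect_eq dual_zero[OF fg] dual_add[OF fg] dual_scale[OF fg], simp_all)
    ultimately have "span (\<Union>\<D>) \<subseteq> {y. (f - g) y = 0}" by (intro span_minimal)
    then show ?thesis unfolding total by (auto simp: fun_eq_iff)
  qed
  have R_exists: "\<exists>f. R x f" for x
  proof -
    have "subspace {x. \<exists>f. R x f}"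
    proof (rule subspaceI)
      show "0 \<in> {x. \<exists>f. R x f}"
        by (intro CollectI exI[of _ 0]) (simp add: R_def dual_closed left_act_zero subspace_0[OF subC])
    qed (use R_add R_scale in blast)+
    moreover have "\<Union>\<D> \<subseteq> {x. \<exists>f. R x f}"
    proof clarify
      fix x D assume x: "x \<in> D" and D: "D \<in> \<D>"
      interpret S: simple_summand scale \<Delta> \<epsilon> D "C D" by (rule summand[OF D])
      obtain f where f: "f \<in> S.dual_D" "left_act f (z D) = x"
        using S.central_element_generates(1)[OF z(1,2,3)[OF D] x] by blast
      have "x - left_act f (z E) \<in> C E" if E: "E \<in> \<D>" for E
      proof (cases "E = D")
        case True
        then show ?thesis using f subspace_0[OF subC] by simp
      next
        case False
        interpret T: simple_summand scale \<Delta> \<epsilon> E "C E" by (rule summand[OF E])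
        have "E \<subseteq> C D" "x \<in> C E" using False E D x by (auto simp: C_def intro: span_base)
        then have "left_act f (z E) = left_act 0 (z E)"
          using f S.dual_D_def by (intro T.left_act_cong z(1)[OF E]) (auto simp: dual_closed)
        then show ?thesis using \<open>x \<in> C E\<close> by (simp add: left_act_zero)
      qed
      then show "\<exists>f. R x f" using f S.dual_D_dual by (auto simp: R_def)
    qed
    ultimately have "span (\<Union>\<D>) \<subseteq> {x. \<exists>f. R x f}" by (intro span_minimal)
    then show ?thesis unfolding total by blast
  qed
  define \<phi> where "\<phi> x = (THE f. R x f)" for x
  have ex1: "\<exists>!f. R x f" for x by (rule ex_ex1I[OF R_exists R_unique])
  have \<phi>: "R x (\<phi> x)" for x unfolding \<phi>_def by (rule theI'[OF ex1])
  have \<phi>_eq: "\<phi> x = f" if "R x f" for x f using R_unique[OF \<phi> that] .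
  have "bimodule_morphism_to_dual \<phi>"
    unfolding bimodule_morphism_to_dual_def
    by (intro conjI allI ballI R_dual[OF \<phi>] \<phi>_eq R_add[OF \<phi> \<phi>, unfolded plus_fun_def]
        R_scale[OF \<phi>] R_left[OF \<phi>] R_right[OF \<phi>])
  moreover have "inj \<phi>"
  proof (rule injI)
    fix x y assume "\<phi> x = \<phi> y"
    then have xy: "x - left_act (\<phi> x) (z D) \<in> C D" "y - left_act (\<phi> x) (z D) \<in> C D" if "D \<in> \<D>" for D
      using \<phi>[of x] \<phi>[of y] that by (auto simp: R_def)
    have "x - y \<in> C D" if "D \<in> \<D>" for D
      using subspace_diff[OF subC xy[OF that]] by simp
    then have "x - y = 0"
      using indep subD total by (intro eq_0_if_in_all_complements[of \<D>]) (auto simp: C_def)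
    then show "x = y" by simp
  qed
  ultimately show ?thesis unfolding symmetric_def by blast
qed

end
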